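(* Let $k$ be an algebraically closed field and $m,n$ positive integers. Then any $C_n$-grading of the matrix algebra $\mathrm{M}_m(k)$, where $C_n$ is the cyclic group of order $n$, is isomorphic to a good grading.
   Context: For a group $G$, a $G$-grading of a $k$-algebra $A$ is a decomposition $A=\bigoplus_{g\in G}A_g$ into $k$-subspaces with $A_gA_h\subseteq A_{gh}$ for all $g,h\in G$. Two gradings are isomorphic if there is a $k$-algebra isomorphism mapping each degree-$g$ component onto the degree-$g$ component. A grading of $\mathrm{M}_m(k)$ is good if all the matrix units $e_{ij}$ are homogeneous elements. *)

theory Defs
  imports
    "Jordan_Normal_Form.VS_Connect"
    "HOL-Algebra.Elementary_Groups"
    "HOL-Algebra.QuotRing"
begin

(* HOL-Algebra's own locale "algebra" is restricted to commutative algebras. *)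
definition k_algebra :: "('k, 'c) ring_scheme \<Rightarrow> ('k, 'a, 'd) module_scheme \<Rightarrow> bool" where
  "k_algebra K A \<longleftrightarrow> vectorspace K A \<and> ring A \<and>
     (\<forall>c\<in>carrier K. \<forall>x\<in>carrier A. \<forall>y\<in>carrier A.
        (c \<odot>\<^bsub>A\<^esub> x) \<otimes>\<^bsub>A\<^esub> y = c \<odot>\<^bsub>A\<^esub> (x \<otimes>\<^bsub>A\<^esub> y) \<and>
        x \<otimes>\<^bsub>A\<^esub> (c \<odot>\<^bsub>A\<^esub> y) = c \<odot>\<^bsub>A\<^esub> (x \<otimes>\<^bsub>A\<^esub> y))"

(* The index set I may be infinite, so the families of components have finite support;
   extensionality of f outside I is what makes "exists exactly one" meaningful. *)
definition internal_direct_sum ::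
  "('k, 'a, 'd) module_scheme \<Rightarrow> 'i set \<Rightarrow> ('i \<Rightarrow> 'a set) \<Rightarrow> bool" where
  "internal_direct_sum A I \<A> \<longleftrightarrow>
     (\<forall>x\<in>carrier A. \<exists>!f. f \<in> (\<Pi>\<^sub>E i\<in>I. \<A> i) \<and> finite {i \<in> I. f i \<noteq> \<zero>\<^bsub>A\<^esub>} \<and>
        x = finsum A f {i \<in> I. f i \<noteq> \<zero>\<^bsub>A\<^esub>})"

(* Only the values \<A> g with g \<in> carrier G are relevant. *)
definition algebra_grading ::
  "('k, 'c) ring_scheme \<Rightarrow> ('k, 'a, 'd) module_scheme \<Rightarrow> ('g, 'e) monoid_scheme \<Rightarrow>
    ('g \<Rightarrow> 'a set) \<Rightarrow> bool" where
  "algebra_grading K A G \<A> \<longleftrightarrow> k_algebra K A \<and> group G \<and>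
     (\<forall>g\<in>carrier G. VectorSpace.subspace K (\<A> g) A) \<and>
     internal_direct_sum A (carrier G) \<A> \<and>
     (\<forall>g\<in>carrier G. \<forall>h\<in>carrier G. \<forall>x\<in>\<A> g. \<forall>y\<in>\<A> h.
        x \<otimes>\<^bsub>A\<^esub> y \<in> \<A> (g \<otimes>\<^bsub>G\<^esub> h))"

definition algebra_iso ::
  "('k, 'c) ring_scheme \<Rightarrow> ('k, 'a, 'd) module_scheme \<Rightarrow> ('k, 'b, 'e) module_scheme \<Rightarrow>
    ('a \<Rightarrow> 'b) set" where
  "algebra_iso K A B = {\<phi> \<in> ring_iso A B.
     \<forall>c\<in>carrier K. \<forall>x\<in>carrier A. \<phi> (c \<odot>\<^bsub>A\<^esub> x) = c \<odot>\<^bsub>B\<^esub> \<phi> x}"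

definition grading_isomorphic ::
  "('k, 'c) ring_scheme \<Rightarrow> ('g, 'f) monoid_scheme \<Rightarrow>
    ('k, 'a, 'd) module_scheme \<Rightarrow> ('g \<Rightarrow> 'a set) \<Rightarrow>
    ('k, 'b, 'e) module_scheme \<Rightarrow> ('g \<Rightarrow> 'b set) \<Rightarrow> bool" where
  "grading_isomorphic K G A \<A> B \<B> \<longleftrightarrow>
     (\<exists>\<phi>\<in>algebra_iso K A B. \<forall>g\<in>carrier G. \<phi> ` \<A> g = \<B> g)"

definition homogeneous :: "('g, 'f) monoid_scheme \<Rightarrow> ('g \<Rightarrow> 'a set) \<Rightarrow> 'a \<Rightarrow> bool" where
  "homogeneous G \<A> x \<longleftrightarrow> (\<exists>g\<in>carrier G. x \<in> \<A> g)"

abbreviation matrix_algebra :: "'k::field itself \<Rightarrow> nat \<Rightarrow> ('k, 'k mat) module" where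
  "matrix_algebra ty m \<equiv> module_mat ty m m"

(* Indices are counted from 0, as everywhere for the type mat. *)
definition matrix_unit :: "nat \<Rightarrow> nat \<Rightarrow> nat \<Rightarrow> 'k::field mat" where
  "matrix_unit m i j = mat m m (\<lambda>(p, q). if p = i \<and> q = j then 1 else 0)"

definition good_grading ::
  "nat \<Rightarrow> ('g, 'f) monoid_scheme \<Rightarrow> ('g \<Rightarrow> 'k::field mat set) \<Rightarrow> bool" where
  "good_grading m G \<A> \<longleftrightarrow>
     algebra_grading class_ring (matrix_algebra TYPE('k) m) G \<A> \<and>
     (\<forall>i<m. \<forall>j<m. homogeneous G \<A> (matrix_unit m i j))"

lemma k_algebra_matrix_algebra: "k_algebra class_ring (matrix_algebra TYPE('k::field) m)"
proof -
  interpret V: vectorspace class_ring "matrix_algebra TYPE('k) m" by (rule matrix_vs)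
  have "ring (matrix_algebra TYPE('k) m)"
    by (rule ringI)
       (auto simp: matrix_vs_simps add_mult_distrib_mat mult_add_distrib_mat
         intro!: V.abelian_group_axioms monoidI)
  then show ?thesis
    unfolding k_algebra_def by (auto simp: matrix_vs_simps V.vectorspace_axioms)
qed

end

theory Submission
  imports Defs "Jordan_Normal_Form.Char_Poly" "HOL-Algebra.Multiplicative_Group"
begin

text \<open>The grading of \<open>A = M\<^sub>m(k)\<close> is good up to conjugation as soon as \<open>k\<^sup>m\<close> itself can be graded so that
\<open>A\<close> acts on it as a graded algebra: conjugating by a matrix \<open>T\<close> whose columns are homogeneous of
degrees \<open>d i\<close> makes \<open>e\<^sub>i\<^sub>j\<close> homogeneous of degree \<open>d i (d j)\<inverse>\<close>. Such a grading of \<open>k\<^sup>m\<close> comes from a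
homogeneous element \<open>a\<close> of rank one. If \<open>a = p \<psi>\<^sup>T\<close>, the left ideal \<open>A a\<close> is graded and
isomorphic to \<open>A p = k\<^sup>m\<close>, so that \<open>k\<^sup>m\<close> is the direct sum of the subspaces \<open>A\<^sub>h p\<close>
(\<open>rank_one_annihilator_graded\<close>, \<open>homogeneous_columns\<close>, \<open>homogeneous_if_shifts_basis\<close>).

The point is thus that a homogeneous element of rank one exists
(\<open>homogeneous_rank_one_exists\<close>), and this is where the cyclic group and the algebraically
closed field enter. Among all nonzero homogeneous elements take one, \<open>a = P Q\<close> of degree \<open>g\<close>, of
least rank \<open>r\<close>, with \<open>P\<close> of size \<open>m \<times> r\<close> and \<open>Q\<close> of size \<open>r \<times> m\<close>. The matrices \<open>D x = Q x P\<close>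
satisfy \<open>D x D y = D (x a y)\<close>, so, with degrees shifted by \<open>g\<close>, they form a graded algebra of
\<open>r \<times> r\<close> matrices. By minimality of \<open>r\<close> its nonzero homogeneous elements are invertible: it is a
graded division algebra. Over an algebraically closed field two invertible homogeneous elements of
the same degree are proportional, because some \<open>D x - \<kappa> D y\<close> is singular and hence zero. The support is
closed under multiplication and therefore, in a finite cyclic group, consists of the powers of one
degree \<open>c\<close>. So every homogeneous \<open>D x\<close> is a multiple of a power of a single matrix \<open>D x\<^sub>0\<close>, and an
eigenvector \<open>w\<close> of \<open>D x\<^sub>0\<close> is an eigenvector of all \<open>Q x P\<close>. As \<open>x (P w)\<close> runs through all of \<open>k\<^sup>m\<close>,
the image of \<open>Q\<close> is the line spanned by \<open>w\<close>, and \<open>a = P Q\<close> has rank one.\<close>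

section \<open>Matrices over a field\<close>

text \<open>Associativity with side conditions on dimensions only, which the simplifier can discharge for
products of rectangular matrices without guessing the intermediate sizes.\<close>
lemma assoc_mult_mat_dim:
  fixes A :: "'a::semiring_0 mat"
  assumes "dim_col A = dim_row B" "dim_col B = dim_row C"
  shows "A * B * C = A * (B * C)"
  using assms by (intro assoc_mult_mat[of _ "dim_row A" "dim_col A" _ "dim_col B" _ "dim_col C"]) auto

lemma assoc_mult_mat_vec_dim:
  fixes A :: "'a::comm_semiring_0 mat"
  assumes "dim_col A = dim_row B" "dim_col B = dim_vec v"
  shows "(A * B) *\<^sub>v v = A *\<^sub>v (B *\<^sub>v v)"
  using assms by (intro assoc_mult_mat_vec[of _ "dim_row A" "dim_col A" _ "dim_col B"]) auto

lemma eq_iff_minus_mat_eq_zero: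
  fixes x y :: "'a::ab_group_add mat"
  assumes "x \<in> carrier_mat nr nc" "y \<in> carrier_mat nr nc"
  shows "x = y \<longleftrightarrow> x - y = 0\<^sub>m nr nc"
  using assms by (auto simp: mat_eq_iff)

lemma mult_unit_vec:
  fixes A :: "'k::semiring_1 mat"
  assumes "A \<in> carrier_mat nr nc" "j < nc"
  shows "A *\<^sub>v unit_vec nc j = col A j"
  using assms by (intro eq_vecI) auto

lemma matrix_unit_mult_unit_vec:
  assumes "i < m" "j < m" "k < m"
  shows "matrix_unit m i j *\<^sub>v unit_vec m k = (if k = j then unit_vec m i else (0\<^sub>v m :: 'k::field vec))"
  using assms by (subst mult_unit_vec[of _ m m]) (auto simp: matrix_unit_def)

lemma mult_outer_product:
  fixes x :: "'k::comm_semiring_0 mat"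
  assumes "x \<in> carrier_mat m m" "p \<in> carrier_vec m"
  shows "x * mat m m (\<lambda>(i, j). p $ i * \<psi> j) = mat m m (\<lambda>(i, j). (x *\<^sub>v p) $ i * \<psi> j)"
  using assms
  by (intro eq_matI) (auto simp: scalar_prod_def sum_distrib_right mult.assoc intro!: sum.cong)

lemma injective_mat_mult_eq_zero:
  fixes P :: "'k::field mat"
  assumes P: "P \<in> carrier_mat s r" and Z: "Z \<in> carrier_mat r t"
    and inj: "\<And>v. v \<in> carrier_vec r \<Longrightarrow> P *\<^sub>v v = 0\<^sub>v s \<Longrightarrow> v = 0\<^sub>v r"
    and PZ: "P * Z = 0\<^sub>m s t"
  shows "Z = 0\<^sub>m r t"
proof (rule eq_matI)
  fix i j assume "i < dim_row (0\<^sub>m r t)" "j < dim_col (0\<^sub>m r t)"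
  then have i: "i < r" and j: "j < t" by auto
  have "P *\<^sub>v col Z j = col (P * Z) j" using P Z j by auto
  also have "\<dots> = 0\<^sub>v s" using PZ j by auto
  finally have "col Z j = 0\<^sub>v r" using inj Z j by auto
  then show "Z $$ (i, j) = 0\<^sub>m r t $$ (i, j)"
    using Z i j by (metis carrier_matD index_col index_zero_mat(1) index_zero_vec(1))
qed (use Z in auto)

text \<open>A kernel vector \<open>v\<close> with \<open>v\<^sub>j \<noteq> 0\<close> expresses column \<open>j\<close> of \<open>Y\<close> through the others. So \<open>Y\<^sub>1\<close> consists of
the remaining columns, and \<open>Y\<^sub>2\<close> records how each column of \<open>Y\<close> is recovered from them. This is what
turns minimality of the inner size of a factorization into injectivity.\<close>
lemma non_injective_factors_through_smaller:
  fixes Y :: "'k::field mat"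
  assumes Y: "Y \<in> carrier_mat s r" and v: "v \<in> carrier_vec r" "v \<noteq> 0\<^sub>v r"
    and Yv: "Y *\<^sub>v v = 0\<^sub>v s"
  obtains r' Y1 Y2 where "r' < r" "Y1 \<in> carrier_mat s r'" "Y2 \<in> carrier_mat r' r" "Y = Y1 * Y2"
proof -
  obtain j where j: "j < r" "v $ j \<noteq> 0"
    using v by (metis carrier_vecD eq_vecI index_zero_vec(1) index_zero_vec(2))
  define skip where "skip = (\<lambda>k. if k < j then k else Suc k)"
  have skip: "bij_betw skip {..<r - 1} ({..<r} - {j})"
  proof (rule bij_betwI[where g = "\<lambda>l. if l < j then l else l - 1"])
  qed (use j in \<open>auto simp: skip_def split: if_splits\<close>)
  define Y1 where "Y1 = mat s (r - 1) (\<lambda>(i, k). Y $$ (i, skip k))"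
  define Y2 where "Y2 = mat (r - 1) r
    (\<lambda>(k, l). if l = j then - (v $ skip k / v $ j) else if l = skip k then 1 else 0)"
  have "Y = Y1 * Y2"
  proof (rule eq_matI)
    fix i l assume "i < dim_row (Y1 * Y2)" "l < dim_col (Y1 * Y2)"
    then have i: "i < s" and l: "l < r" by (auto simp: Y1_def Y2_def)
    have "(Y1 * Y2) $$ (i, l) = (\<Sum>k<r - 1. Y $$ (i, skip k) *
        (if l = j then - (v $ skip k / v $ j) else if l = skip k then 1 else 0))"
      using i l by (auto simp: Y1_def Y2_def scalar_prod_def atLeast0LessThan intro!: sum.cong)
    also have "\<dots> = (\<Sum>q\<in>{..<r} - {j}. Y $$ (i, q) *
        (if l = j then - (v $ q / v $ j) else if l = q then 1 else 0))"
      by (rule sum.reindex_bij_betw[OF skip])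
    also have "\<dots> = Y $$ (i, l)"
    proof (cases "l = j")
      case True
      have "0 = (Y *\<^sub>v v) $ i" using Yv i by simp
      also have "\<dots> = (\<Sum>q<r. Y $$ (i, q) * v $ q)"
        using Y v i by (auto simp: scalar_prod_def atLeast0LessThan intro!: sum.cong)
      also have "\<dots> = Y $$ (i, j) * v $ j + (\<Sum>q\<in>{..<r} - {j}. Y $$ (i, q) * v $ q)"
        using j by (intro sum.remove) auto
      finally have "(\<Sum>q\<in>{..<r} - {j}. Y $$ (i, q) * v $ q) = - (Y $$ (i, j) * v $ j)"
        by (simp add: eq_neg_iff_add_eq_0 add.commute)
      then have "- ((\<Sum>q\<in>{..<r} - {j}. Y $$ (i, q) * v $ q) / v $ j) = Y $$ (i, j)"
        using j by simp
      then show ?thesis using True by (simp add: sum_divide_distrib sum_negf)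
    next
      case False
      then have "(\<Sum>q\<in>{..<r} - {j}. Y $$ (i, q) *
          (if l = j then - (v $ q / v $ j) else if l = q then 1 else 0))
        = (\<Sum>q\<in>{..<r} - {j}. if l = q then Y $$ (i, q) else 0)"
        by (intro sum.cong) auto
      then show ?thesis using False l by simp
    qed
    finally show "Y $$ (i, l) = (Y1 * Y2) $$ (i, l)" by simp
  qed (use Y in \<open>auto simp: Y1_def Y2_def\<close>)
  moreover have "r - 1 < r" using j by simp
  moreover have "Y1 \<in> carrier_mat s (r - 1)" "Y2 \<in> carrier_mat (r - 1) r"
    by (simp_all add: Y1_def Y2_def)
  ultimately show ?thesis by (intro that)
qed

lemma pencil_kernel_iff:
  fixes C Y :: "'k::field mat"
  assumes "C \<in> carrier_mat r r" "Y \<in> carrier_mat r r" "v \<in> carrier_vec r"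
  shows "(Y - \<mu> \<cdot>\<^sub>m C) *\<^sub>v v = 0\<^sub>v r \<longleftrightarrow> Y *\<^sub>v v = \<mu> \<cdot>\<^sub>v (C *\<^sub>v v)"
proof -
  have "(Y - \<mu> \<cdot>\<^sub>m C) *\<^sub>v v = Y *\<^sub>v v - (\<mu> \<cdot>\<^sub>m C) *\<^sub>v v"
    using assms by (intro minus_mult_distrib_mat_vec) auto
  also have "(\<mu> \<cdot>\<^sub>m C) *\<^sub>v v = \<mu> \<cdot>\<^sub>v (C *\<^sub>v v)" using assms by auto
  finally show ?thesis using assms by (auto simp: vec_eq_iff)
qed

text \<open>Here \<open>C\<close> is invertible, and \<open>\<mu>\<close> is an eigenvalue of \<open>C\<inverse> Y\<close>; it exists since the field is
algebraically closed.\<close>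
lemma pencil_has_kernel:
  fixes C Y :: "'k::alg_closed_field mat"
  assumes r: "r > 0" and C: "C \<in> carrier_mat r r" and Y: "Y \<in> carrier_mat r r"
    and inj: "\<And>v. v \<in> carrier_vec r \<Longrightarrow> C *\<^sub>v v = 0\<^sub>v r \<Longrightarrow> v = 0\<^sub>v r"
  obtains \<mu> v where "v \<in> carrier_vec r" "v \<noteq> 0\<^sub>v r" "(Y - \<mu> \<cdot>\<^sub>m C) *\<^sub>v v = 0\<^sub>v r"
proof -
  have "det C \<noteq> 0" using det_0_iff_vec_prod_zero_field[OF C] inj by blast
  from det_non_zero_imp_unit[OF C this, of "()"] obtain B where
    B: "B \<in> carrier_mat r r" and CB: "C * B = 1\<^sub>m r"
    unfolding Units_def ring_mat_simps by auto
  have BY: "B * Y \<in> carrier_mat r r" using B Y by simp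
  have "degree (char_poly (B * Y)) > 0" using degree_monic_char_poly[OF BY] r by simp
  then obtain \<mu> where "eigenvalue (B * Y) \<mu>"
    using alg_closed_imp_poly_has_root eigenvalue_root_char_poly[OF BY] by blast
  then obtain v where v: "v \<in> carrier_vec r" "v \<noteq> 0\<^sub>v r" and ev: "(B * Y) *\<^sub>v v = \<mu> \<cdot>\<^sub>v v"
    unfolding eigenvalue_def eigenvector_def using BY by auto
  have "Y *\<^sub>v v = (C * B) *\<^sub>v (Y *\<^sub>v v)" using CB Y v by simp
  also have "\<dots> = C *\<^sub>v ((B * Y) *\<^sub>v v)" using C B Y v
    by (metis assoc_mult_mat_vec mult_mat_vec_carrier)
  also have "\<dots> = \<mu> \<cdot>\<^sub>v (C *\<^sub>v v)" unfolding ev using C v by (simp add: mult_mat_vec)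
  finally have "(Y - \<mu> \<cdot>\<^sub>m C) *\<^sub>v v = 0\<^sub>v r"
    using pencil_kernel_iff[OF C Y v(1)] by simp
  with v that show ?thesis by blast
qed

text \<open>The algebra of all matrices is prime: if the entry \<open>a\<^sub>i\<^sub>j\<close> is nonzero, then \<open>a e\<^sub>j\<^sub>i a\<close> has the entry
\<open>a\<^sub>i\<^sub>j\<^sup>2\<close> at \<open>(i, j)\<close>.\<close>
lemma exists_sandwich_nonzero:
  fixes a :: "'k::field mat"
  assumes a: "a \<in> carrier_mat m m" "a \<noteq> 0\<^sub>m m m"
  obtains x where "x \<in> carrier_mat m m" "a * x * a \<noteq> 0\<^sub>m m m"
proof -
  obtain i j where ij: "i < m" "j < m" "a $$ (i, j) \<noteq> 0"
    using a by (metis carrier_matD eq_matI index_zero_mat)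
  define x :: "'k mat" where "x = mat m m (\<lambda>(p, q). if q = i then if p = j then 1 else 0 else 0)"
  have x: "x \<in> carrier_mat m m" by (simp add: x_def)
  have xa: "(a * x) $$ (i, s) = (if s = i then a $$ (i, j) else 0)" if "s < m" for s
    using that ij a by (simp add: x_def scalar_prod_def if_distrib[of "(*) _"] cong: if_cong)
  have "(a * x * a) $$ (i, j) = row (a * x) i \<bullet> col a j"
    using ij a x by (intro index_mult_mat(1)) auto
  also have "\<dots> = (\<Sum>s<m. (a * x) $$ (i, s) * a $$ (s, j))"
    unfolding scalar_prod_def using ij a x by (intro sum.cong) auto
  also have "\<dots> = (\<Sum>s<m. if s = i then a $$ (i, j) * a $$ (i, j) else 0)"
    by (intro sum.cong) (auto simp: xa)
  also have "\<dots> = a $$ (i, j) * a $$ (i, j)" using ij by simp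
  finally have "(a * x * a) $$ (i, j) \<noteq> 0" using ij by simp
  then have "a * x * a \<noteq> 0\<^sub>m m m" using ij by auto
  with x that show ?thesis by blast
qed

lemma exists_mat_mapping_to:
  fixes p u :: "'k::field vec"
  assumes p: "p \<in> carrier_vec m" "p \<noteq> 0\<^sub>v m" and u: "u \<in> carrier_vec m"
  obtains x where "x \<in> carrier_mat m m" "x *\<^sub>v p = u"
proof -
  obtain l where l: "l < m" "p $ l \<noteq> 0"
    using p by (metis carrier_vecD eq_vecI index_zero_vec)
  define x where "x = mat m m (\<lambda>(i, j). if j = l then u $ i / p $ l else 0)"
  have "x *\<^sub>v p = u"
  proof (rule eq_vecI)
    fix i assume "i < dim_vec u"
    then have i: "i < m" using u by simp
    then have "(x *\<^sub>v p) $ i = (\<Sum>j<m. (if j = l then u $ i / p $ l else 0) * p $ j)"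
      using p by (auto simp: x_def scalar_prod_def atLeast0LessThan intro!: sum.cong)
    also have "\<dots> = (\<Sum>j<m. if j = l then u $ i / p $ l * p $ l else 0)"
      by (intro sum.cong) auto
    also have "\<dots> = u $ i" using l by simp
    finally show "(x *\<^sub>v p) $ i = u $ i" .
  qed (use u in \<open>auto simp: x_def\<close>)
  moreover have "x \<in> carrier_mat m m" by (simp add: x_def)
  ultimately show ?thesis using that by blast
qed

lemma conjugation_algebra_iso:
  fixes S T :: "'k::field mat"
  assumes S: "S \<in> carrier_mat m m" and T: "T \<in> carrier_mat m m"
    and ST: "S * T = 1\<^sub>m m" and TS: "T * S = 1\<^sub>m m"
  shows "(\<lambda>x. S * x * T) \<in> algebra_iso class_ring (matrix_algebra TYPE('k) m) (matrix_algebra TYPE('k) m)"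
proof -
  have mult: "S * (x * y) * T = (S * x * T) * (S * y * T)"
    if "x \<in> carrier_mat m m" "y \<in> carrier_mat m m" for x y
  proof -
    have "(S * x * T) * (S * y * T) = S * x * (T * S) * y * T"
      using S T that by (simp add: assoc_mult_mat_dim)
    then show ?thesis unfolding TS using S T that by (simp add: assoc_mult_mat_dim)
  qed
  have add: "S * (x + y) * T = S * x * T + S * y * T"
    if "x \<in> carrier_mat m m" "y \<in> carrier_mat m m" for x y
    using S T that by (simp add: mult_add_distrib_mat[of S m m] add_mult_distrib_mat[of _ m m _ T m])
  have smult: "S * (c \<cdot>\<^sub>m x) * T = c \<cdot>\<^sub>m (S * x * T)" if "x \<in> carrier_mat m m" for c x
    using S T that by (simp add: mult_smult_distrib[of S m m] mult_smult_assoc_mat[of _ m m T m])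
  have cancel: "A * (B * x * A) * B = x" if "x \<in> carrier_mat m m" "A \<in> carrier_mat m m"
    "B \<in> carrier_mat m m" "A * B = 1\<^sub>m m" for A B x :: "'k mat"
  proof -
    have "A * (B * x * A) * B = (A * B) * x * (A * B)" using that(1-3) by (simp add: assoc_mult_mat_dim)
    then show ?thesis unfolding that(4) using that(1) by simp
  qed
  have "bij_betw (\<lambda>x. S * x * T) (carrier_mat m m) (carrier_mat m m)"
    by (rule bij_betwI[where g = "\<lambda>x. T * x * S"])
       (use S T cancel[OF _ T S TS] cancel[OF _ S T ST] in auto)
  then show ?thesis
    unfolding algebra_iso_def ring_iso_def Ring.ring_hom_def
    using S T ST mult add smult by (auto simp: module_mat_simps)
qed

section \<open>Subsemigroups of finite cyclic groups\<close>

text \<open>In terms of a generator \<open>z\<close> of the group, \<open>c\<close> is \<open>z\<^sup>k\<close> with the least positive \<open>k\<close> such that \<open>z\<^sup>k\<close> lies in \<open>T\<close>;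
division with remainder does the rest. The exponents are positive, as for the elements of a
semigroup generated by \<open>c\<close>, so that a property of \<open>c\<close> passes to all of \<open>T\<close> by
multiplication alone.\<close>
lemma cyclic_subsemigroup_has_generator:
  fixes G :: "('g, 'e) monoid_scheme" (structure)
  assumes "group G" "cyclic_group G" and fin: "finite (carrier G)"
    and T: "T \<subseteq> carrier G" "T \<noteq> {}"
    and mult: "\<And>h h'. h \<in> T \<Longrightarrow> h' \<in> T \<Longrightarrow> h \<otimes> h' \<in> T"
  obtains c where "c \<in> T" "\<And>h. h \<in> T \<Longrightarrow> \<exists>j::nat. h = c [^] Suc j"
proof -
  interpret group G by fact
  obtain z where z: "z \<in> carrier G" and "subgroup_generated G {z} = G"
    using assms(2) unfolding cyclic_group_def by blast
  with carrier_subgroup_generated[of G "{z}"] have gen: "carrier G = generate G {z}" by simp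
  define n where "n = Coset.order G"
  have n: "n > 0" unfolding n_def using fin order_gt_0_iff_finite by blast
  have zn: "z [^] n = \<one>" unfolding n_def using pow_order_eq_1[OF z] by simp
  have pow_add: "z [^] (a + n * b) = z [^] a" for a b :: nat
    using z by (simp add: nat_pow_mult[symmetric] nat_pow_pow[symmetric] zn)
  have exp: "\<exists>a::nat. a > 0 \<and> h = z [^] a" if h: "h \<in> carrier G" for h
  proof -
    from h gen obtain a :: nat where "h = z [^] a"
      using generate_pow_on_finite_carrier[OF fin z] by auto
    then show ?thesis using n pow_add[of a 1] by (intro exI[of _ "a + n"]) auto
  qed
  define k where "k = (LEAST k::nat. k > 0 \<and> z [^] k \<in> T)"
  have "\<exists>k::nat. k > 0 \<and> z [^] k \<in> T" using T exp by blast
  from LeastI_ex[OF this] have k: "k > 0" "z [^] k \<in> T" unfolding k_def by auto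
  have least: "k \<le> s" if "s > 0" "z [^] s \<in> T" for s
    unfolding k_def using that by (intro Least_le) auto
  have kpow: "(z [^] k) [^] Suc j \<in> T" for j
    by (induction j) (use k T mult in auto)
  have power: "\<exists>j::nat. h = (z [^] k) [^] Suc j" if h: "h \<in> T" for h
  proof -
    from h T(1) exp obtain a :: nat where a: "a > 0" "h = z [^] a" by blast
    define q where "q = a div k"
    define s where "s = a mod k"
    have aq: "a = s + q * k" unfolding q_def s_def by simp
    have "s = 0"
    proof (rule ccontr)
      assume "s \<noteq> 0"
      \<comment> \<open>Multiply \<open>h\<close> by a power of \<open>z\<^sup>k\<close> with positive exponent congruent to \<open>-q\<close> modulo \<open>n\<close>.\<close>
      obtain e where e: "q * (n - 1) + n = Suc e" using n by (cases "q * (n - 1) + n") auto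
      have qn: "q + q * (n - 1) = q * n" using n by (cases n) auto
      have "h \<otimes> (z [^] k) [^] Suc e = z [^] (a + k * Suc e)"
        using z a by (simp only: nat_pow_pow nat_pow_mult)
      also have "a + k * Suc e = s + k * (q + q * (n - 1) + n)"
        unfolding e[symmetric] aq by (simp add: algebra_simps)
      also have "\<dots> = s + n * (k * q + k)" unfolding qn by (simp add: algebra_simps)
      also have "z [^] \<dots> = z [^] s" by (rule pow_add)
      finally have "z [^] s \<in> T" using mult[OF h kpow[of e]] by simp
      then have "k \<le> s" using least \<open>s \<noteq> 0\<close> by simp
      moreover have "s < k" unfolding s_def using k by simp
      ultimately show False by simp
    qed
    then have "h = (z [^] k) [^] q" using a aq z by (simp add: nat_pow_pow mult.commute)
    moreover have "q > 0" using a aq \<open>s = 0\<close> by (cases q) auto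
    ultimately show ?thesis by (metis Suc_pred)
  qed
  show ?thesis by (rule that[OF k(2) power])
qed

section \<open>Sums of families of matrices\<close>

text \<open>Families of matrices are summed entrywise, which gives access to the library of finite sums over a
type. On square matrices this is the sum in the matrix algebra, see \<open>finsum_matrix_algebra\<close>.\<close>
definition sum_mat :: "nat \<Rightarrow> nat \<Rightarrow> ('i \<Rightarrow> 'a::comm_monoid_add mat) \<Rightarrow> 'i set \<Rightarrow> 'a mat" where
  "sum_mat nr nc f I = mat nr nc (\<lambda>(i, j). \<Sum>g\<in>I. f g $$ (i, j))"

lemma sum_mat_carrier [simp]: "sum_mat nr nc f I \<in> carrier_mat nr nc"
  by (simp add: sum_mat_def)

lemma sum_mat_dim [simp]:
  "dim_row (sum_mat nr nc f I) = nr" "dim_col (sum_mat nr nc f I) = nc"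
  by (simp_all add: sum_mat_def)

lemma sum_mat_index [simp]:
  "i < nr \<Longrightarrow> j < nc \<Longrightarrow> sum_mat nr nc f I $$ (i, j) = (\<Sum>g\<in>I. f g $$ (i, j))"
  by (simp add: sum_mat_def)

lemma sum_mat_empty: "sum_mat nr nc f {} = 0\<^sub>m nr nc"
  by (auto simp: sum_mat_def)

lemma sum_mat_insert:
  assumes "finite I" "a \<notin> I" "f a \<in> carrier_mat nr nc"
  shows "sum_mat nr nc f (insert a I) = f a + sum_mat nr nc f I"
  using assms by (intro eq_matI) (auto simp: sum_mat_def)

lemma sum_mat_cong:
  assumes "\<And>g. g \<in> I \<Longrightarrow> f g = f' g"
  shows "sum_mat nr nc f I = sum_mat nr nc f' I"
  using assms by (simp add: sum_mat_def cong: sum.cong)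

lemma sum_mat_minus:
  fixes f f' :: "'i \<Rightarrow> 'a::ab_group_add mat"
  assumes "\<And>g. g \<in> I \<Longrightarrow> f g \<in> carrier_mat nr nc" "\<And>g. g \<in> I \<Longrightarrow> f' g \<in> carrier_mat nr nc"
  shows "sum_mat nr nc (\<lambda>g. f g - f' g) I = sum_mat nr nc f I - sum_mat nr nc f' I"
proof (rule eq_matI)
  fix i j assume "i < dim_row (sum_mat nr nc f I - sum_mat nr nc f' I)"
    "j < dim_col (sum_mat nr nc f I - sum_mat nr nc f' I)"
  then have "i < nr" "j < nc" by (auto simp: sum_mat_def)
  moreover from this have "(\<Sum>g\<in>I. (f g - f' g) $$ (i, j)) = (\<Sum>g\<in>I. f g $$ (i, j) - f' g $$ (i, j))"
    using assms by (intro sum.cong) (auto dest!: assms)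
  ultimately show "sum_mat nr nc (\<lambda>g. f g - f' g) I $$ (i, j)
      = (sum_mat nr nc f I - sum_mat nr nc f' I) $$ (i, j)"
    using carrier_matD[OF sum_mat_carrier[of nr nc f' I]] by (simp add: sum_subtractf)
qed (auto simp: sum_mat_def)

lemma sum_mat_nonzero_terms:
  assumes "finite I"
  shows "sum_mat nr nc f {g \<in> I. f g \<noteq> 0\<^sub>m nr nc} = sum_mat nr nc f I"
  using assms by (intro eq_matI) (auto simp: intro!: sum.mono_neutral_left)

lemma mult_sum_mat_mult:
  fixes f :: "'i \<Rightarrow> 'a::semiring_1 mat"
  assumes "finite I" and f: "\<And>g. g \<in> I \<Longrightarrow> f g \<in> carrier_mat p q"
    and L: "L \<in> carrier_mat nr p" and R: "R \<in> carrier_mat q nc"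
  shows "L * sum_mat p q f I * R = sum_mat nr nc (\<lambda>g. L * f g * R) I"
  using assms(1,2)
proof (induction I)
  case empty
  then show ?case using L R by (simp add: sum_mat_empty)
next
  case (insert a I)
  have a: "f a \<in> carrier_mat p q" using insert.prems by simp
  have IH: "L * sum_mat p q f I * R = sum_mat nr nc (\<lambda>g. L * f g * R) I"
    using insert.IH insert.prems by simp
  have "L * sum_mat p q f (insert a I) * R = L * (f a + sum_mat p q f I) * R"
    using a insert.hyps by (simp add: sum_mat_insert)
  also have "\<dots> = L * f a * R + L * sum_mat p q f I * R"
    using L R a by (simp add: mult_add_distrib_mat[of L nr p] add_mult_distrib_mat[of _ nr q _ R nc])
  also have "\<dots> = sum_mat nr nc (\<lambda>g. L * f g * R) (insert a I)"
    unfolding IH using L R a insert.hyps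
    by (intro sum_mat_insert[symmetric]) auto
  finally show ?case .
qed

lemma sum_mat_mult_vec_index:
  fixes f :: "'i \<Rightarrow> 'a::comm_ring_1 mat"
  assumes "\<And>g. g \<in> I \<Longrightarrow> f g \<in> carrier_mat nr nc" "v \<in> carrier_vec nc" "i < nr"
  shows "(sum_mat nr nc f I *\<^sub>v v) $ i = (\<Sum>g\<in>I. (f g *\<^sub>v v) $ i)"
proof -
  have "(sum_mat nr nc f I *\<^sub>v v) $ i = (\<Sum>j<nc. (\<Sum>g\<in>I. f g $$ (i, j)) * v $ j)"
    using assms(2,3) carrier_matD[OF sum_mat_carrier[of nr nc f I]]
    by (auto simp: scalar_prod_def atLeast0LessThan intro!: sum.cong)
  also have "\<dots> = (\<Sum>g\<in>I. \<Sum>j<nc. f g $$ (i, j) * v $ j)"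
    by (simp add: sum_distrib_right sum.swap[of _ I])
  also have "\<dots> = (\<Sum>g\<in>I. (f g *\<^sub>v v) $ i)"
    using assms(2,3) carrier_matD[OF assms(1)]
    by (auto simp: scalar_prod_def atLeast0LessThan intro!: sum.cong)
  finally show ?thesis .
qed

lemma finsum_matrix_algebra:
  assumes "finite I" "\<And>g. g \<in> I \<Longrightarrow> f g \<in> carrier_mat m m"
  shows "finsum (matrix_algebra TYPE('k::field) m) f I = sum_mat m m f I"
  using assms
proof (induction I)
  case empty
  interpret A: abelian_group "matrix_algebra TYPE('k) m" by (rule abelian_group_mat)
  show ?case by (simp add: sum_mat_empty module_mat_simps)
next
  case (insert a I)
  interpret A: abelian_group "matrix_algebra TYPE('k) m" by (rule abelian_group_mat)
  from insert show ?case
    by (subst A.finsum_insert) (auto simp: module_mat_simps sum_mat_insert)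
qed

section \<open>Gradings of matrix algebras by finite groups\<close>

text \<open>A grading by a finite group, with the direct sum expressed by existence of a decomposition and by
independence of the components. In this form a homogeneous family is summed over the whole group,
and its values outside the group are immaterial.\<close>
locale matrix_grading = group G for G :: "('g, 'e) monoid_scheme" (structure) +
  fixes m :: nat and \<A> :: "'g \<Rightarrow> 'k::field mat set"
  assumes finite_carrier: "finite (carrier G)"
    and component_carrier: "g \<in> carrier G \<Longrightarrow> x \<in> \<A> g \<Longrightarrow> x \<in> carrier_mat m m"
    and zero_mem: "g \<in> carrier G \<Longrightarrow> 0\<^sub>m m m \<in> \<A> g"
    and add_mem: "g \<in> carrier G \<Longrightarrow> x \<in> \<A> g \<Longrightarrow> y \<in> \<A> g \<Longrightarrow> x + y \<in> \<A> g"
    and smult_mem: "g \<in> carrier G \<Longrightarrow> x \<in> \<A> g \<Longrightarrow> c \<cdot>\<^sub>m x \<in> \<A> g"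
    and mult_mem: "g \<in> carrier G \<Longrightarrow> h \<in> carrier G \<Longrightarrow> x \<in> \<A> g \<Longrightarrow> y \<in> \<A> h \<Longrightarrow>
      x * y \<in> \<A> (g \<otimes> h)"
    and decomposition: "x \<in> carrier_mat m m \<Longrightarrow>
      \<exists>f. (\<forall>g\<in>carrier G. f g \<in> \<A> g) \<and> x = sum_mat m m f (carrier G)"
    and independent: "(\<And>g. g \<in> carrier G \<Longrightarrow> f g \<in> \<A> g) \<Longrightarrow>
      sum_mat m m f (carrier G) = 0\<^sub>m m m \<Longrightarrow> g \<in> carrier G \<Longrightarrow> f g = 0\<^sub>m m m"
begin

lemma minus_mem:
  assumes "g \<in> carrier G" "x \<in> \<A> g" "y \<in> \<A> g"
  shows "x - y \<in> \<A> g"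
proof -
  have "x - y = x + (- 1) \<cdot>\<^sub>m y"
    using assms component_carrier by (intro eq_matI) (auto dest!: component_carrier)
  then show ?thesis using assms add_mem smult_mem by simp
qed

end

text \<open>Independence follows by comparing two decompositions of the zero matrix: a given family with zero
sum, and the zero family.\<close>
lemma matrix_grading_if_algebra_grading:
  fixes \<A> :: "'g \<Rightarrow> 'k::field mat set"
  assumes fin: "finite (carrier G)"
    and gr: "algebra_grading class_ring (matrix_algebra TYPE('k) m) G \<A>"
  shows "matrix_grading G m \<A>"
proof -
  let ?A = "matrix_algebra TYPE('k) m"
  from gr have G: "group G"
    and sub: "\<And>g. g \<in> carrier G \<Longrightarrow> VectorSpace.subspace class_ring (\<A> g) ?A"
    and ds: "internal_direct_sum ?A (carrier G) \<A>"
    and mult: "\<And>g h x y. \<lbrakk>g \<in> carrier G; h \<in> carrier G; x \<in> \<A> g; y \<in> \<A> h\<rbrakk> \<Longrightarrow>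
        x * y \<in> \<A> (g \<otimes>\<^bsub>G\<^esub> h)"
    unfolding algebra_grading_def by (auto simp: module_mat_simps)
  have sm: "submodule class_ring (\<A> g) ?A" if "g \<in> carrier G" for g
    using sub[OF that] unfolding VectorSpace.subspace_def by blast
  have sub_carrier: "x \<in> carrier_mat m m" if "g \<in> carrier G" "x \<in> \<A> g" for g x
    using submodule.subset[OF sm[OF that(1)]] that(2) by (auto simp: module_mat_simps)
  have zero: "0\<^sub>m m m \<in> \<A> g" if "g \<in> carrier G" for g
    using submodule.zero_closed[OF sm[OF that]] by (simp add: module_mat_simps)
  let ?supp = "\<lambda>f. {g \<in> carrier G. f g \<noteq> \<zero>\<^bsub>?A\<^esub>}"
  have sum_supp: "finsum ?A f (?supp f) = sum_mat m m f (carrier G)"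
    if "\<And>g. g \<in> carrier G \<Longrightarrow> f g \<in> \<A> g" for f
  proof -
    have "finsum ?A f (?supp f) = sum_mat m m f (?supp f)"
      using fin sub_carrier that by (intro finsum_matrix_algebra) auto
    then show ?thesis using sum_mat_nonzero_terms[OF fin, of m m f] by (simp add: module_mat_simps)
  qed
  have fin_supp: "finite (?supp f)" for f using fin by simp
  have ex1: "\<exists>!f. f \<in> (\<Pi>\<^sub>E i\<in>carrier G. \<A> i) \<and> finite (?supp f) \<and> x = finsum ?A f (?supp f)"
    if "x \<in> carrier_mat m m" for x
    using ds that unfolding internal_direct_sum_def by (simp add: module_mat_simps)
  interpret G: group G by fact
  show ?thesis
  proof unfold_locales
    show "finite (carrier G)" by fact
  next
    fix g x assume "g \<in> carrier G" "x \<in> \<A> g"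
    then show "x \<in> carrier_mat m m" by (rule sub_carrier)
  next
    fix g assume "g \<in> carrier G"
    then show "0\<^sub>m m m \<in> \<A> g" by (rule zero)
  next
    fix g x y assume "g \<in> carrier G" "x \<in> \<A> g" "y \<in> \<A> g"
    then show "x + y \<in> \<A> g"
      using submodule.m_closed[OF sm[of g], of x y] by (simp add: module_mat_simps)
  next
    fix g x c assume "g \<in> carrier G" "x \<in> \<A> g"
    then show "c \<cdot>\<^sub>m x \<in> \<A> g"
      using submodule.smult_closed[OF sm[of g], of c x] by (simp add: module_mat_simps)
  next
    fix g h x y assume "g \<in> carrier G" "h \<in> carrier G" "x \<in> \<A> g" "y \<in> \<A> h"
    then show "x * y \<in> \<A> (g \<otimes>\<^bsub>G\<^esub> h)" by (rule mult)
  next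
    fix x :: "'k mat" assume "x \<in> carrier_mat m m"
    then obtain f where f: "f \<in> (\<Pi>\<^sub>E i\<in>carrier G. \<A> i)" "x = finsum ?A f (?supp f)"
      using ex1 by blast
    then have "x = sum_mat m m f (carrier G)" using sum_supp[of f] by auto
    with f show "\<exists>f. (\<forall>g\<in>carrier G. f g \<in> \<A> g) \<and> x = sum_mat m m f (carrier G)" by blast
  next
    fix f g assume f: "\<And>g. g \<in> carrier G \<Longrightarrow> f g \<in> \<A> g"
      and sum0: "sum_mat m m f (carrier G) = 0\<^sub>m m m" and g: "g \<in> carrier G"
    define f' where "f' = restrict f (carrier G)"
    define z where "z = restrict (\<lambda>_. 0\<^sub>m m m :: 'k mat) (carrier G)"
    have f': "f' g \<in> \<A> g" and z: "z g \<in> \<A> g" if "g \<in> carrier G" for g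
      using f zero that by (auto simp: f'_def z_def)
    have "sum_mat m m f' (carrier G) = 0\<^sub>m m m"
      using sum0 sum_mat_cong[of "carrier G" f' f m m] by (simp add: f'_def)
    then have "0\<^sub>m m m = finsum ?A f' (?supp f')" using sum_supp[of f'] f' by simp
    moreover have "sum_mat m m z (carrier G) = 0\<^sub>m m m"
      by (rule eq_matI) (auto simp: z_def)
    then have "0\<^sub>m m m = finsum ?A z (?supp z)" using sum_supp[of z] z by simp
    moreover have "f' \<in> (\<Pi>\<^sub>E i\<in>carrier G. \<A> i)" "z \<in> (\<Pi>\<^sub>E i\<in>carrier G. \<A> i)"
      using f zero by (auto simp: f'_def z_def)
    moreover obtain u where "\<And>f. f \<in> (\<Pi>\<^sub>E i\<in>carrier G. \<A> i) \<Longrightarrow> finite (?supp f) \<Longrightarrow>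
        0\<^sub>m m m = finsum ?A f (?supp f) \<Longrightarrow> f = u"
      using ex1[OF zero_carrier_mat] by (elim ex1E) blast
    ultimately have "f' = u" "z = u" using fin_supp by blast+
    then have "f' = z" by simp
    then have "f' g = z g" by simp
    then show "f g = 0\<^sub>m m m" using g by (simp add: f'_def z_def)
  qed
qed

lemma algebra_grading_if_matrix_grading:
  fixes \<A> :: "'g \<Rightarrow> 'k::field mat set"
  assumes "matrix_grading G m \<A>"
  shows "algebra_grading class_ring (matrix_algebra TYPE('k) m) G \<A>"
proof -
  let ?A = "matrix_algebra TYPE('k) m"
  interpret matrix_grading G m \<A> by fact
  interpret V: vectorspace class_ring ?A by (rule matrix_vs)
  let ?supp = "\<lambda>f. {g \<in> carrier G. f g \<noteq> \<zero>\<^bsub>?A\<^esub>}"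
  have sum_supp: "finsum ?A f (?supp f) = sum_mat m m f (carrier G)"
    if "f \<in> (\<Pi>\<^sub>E i\<in>carrier G. \<A> i)" for f
  proof -
    have "finsum ?A f (?supp f) = sum_mat m m f (?supp f)"
      using finite_carrier component_carrier that by (intro finsum_matrix_algebra) auto
    then show ?thesis
      using sum_mat_nonzero_terms[OF finite_carrier, of m m f] by (simp add: module_mat_simps)
  qed
  have "VectorSpace.subspace class_ring (\<A> g) ?A" if "g \<in> carrier G" for g
    using that component_carrier zero_mem add_mem smult_mem
    by (intro VectorSpace.subspace.intro V.vectorspace_axioms submodule.intro V.module_axioms)
       (auto simp: module_mat_simps)
  moreover have "internal_direct_sum ?A (carrier G) \<A>"
    unfolding internal_direct_sum_def
  proof (intro ballI ex_ex1I)
    fix x assume "x \<in> carrier ?A"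
    then have "x \<in> carrier_mat m m" by (simp add: module_mat_simps)
    from decomposition[OF this] obtain f where
      f: "\<forall>g\<in>carrier G. f g \<in> \<A> g" "x = sum_mat m m f (carrier G)" by blast
    define f' where "f' = restrict f (carrier G)"
    have f': "f' \<in> (\<Pi>\<^sub>E i\<in>carrier G. \<A> i)" using f by (auto simp: f'_def)
    have "x = sum_mat m m f' (carrier G)"
      using f(2) sum_mat_cong[of "carrier G" f' f m m] by (simp add: f'_def)
    then have "x = finsum ?A f' (?supp f')" using sum_supp[OF f'] by simp
    with f' show "\<exists>f. f \<in> (\<Pi>\<^sub>E i\<in>carrier G. \<A> i) \<and> finite (?supp f) \<and> x = finsum ?A f (?supp f)"
      using finite_carrier by auto
  next
    fix x f f'
    assume "f \<in> (\<Pi>\<^sub>E i\<in>carrier G. \<A> i) \<and> finite (?supp f) \<and> x = finsum ?A f (?supp f)"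
      and "f' \<in> (\<Pi>\<^sub>E i\<in>carrier G. \<A> i) \<and> finite (?supp f') \<and> x = finsum ?A f' (?supp f')"
    then have f: "f \<in> (\<Pi>\<^sub>E i\<in>carrier G. \<A> i)" and f': "f' \<in> (\<Pi>\<^sub>E i\<in>carrier G. \<A> i)"
      and eq: "sum_mat m m f (carrier G) = sum_mat m m f' (carrier G)"
      using sum_supp by auto
    have diff: "f g - f' g \<in> \<A> g" if "g \<in> carrier G" for g
      using f f' that by (intro minus_mem) auto
    have "sum_mat m m (\<lambda>g. f g - f' g) (carrier G) = 0\<^sub>m m m"
    proof (subst sum_mat_minus)
      show "sum_mat m m f (carrier G) - sum_mat m m f' (carrier G) = 0\<^sub>m m m"
        unfolding eq by (rule minus_r_inv_mat) simp
    qed (use f f' component_carrier in auto)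
    then have "f g - f' g = 0\<^sub>m m m" if "g \<in> carrier G" for g
      using independent[of "\<lambda>g. f g - f' g"] diff that by blast
    moreover have "f g \<in> carrier_mat m m" "f' g \<in> carrier_mat m m" if "g \<in> carrier G" for g
      using f f' component_carrier that by auto
    ultimately have "f g = f' g" if "g \<in> carrier G" for g
      using that eq_iff_minus_mat_eq_zero by blast
    then show "f = f'" using f f' by (intro PiE_ext) auto
  qed
  ultimately show ?thesis
    unfolding algebra_grading_def using mult_mem group_axioms
    by (auto simp: k_algebra_matrix_algebra module_mat_simps)
qed

lemma matrix_grading_conjugate:
  fixes S T :: "'k::field mat"
  assumes "matrix_grading G m \<A>"
    and S: "S \<in> carrier_mat m m" and T: "T \<in> carrier_mat m m"
    and ST: "S * T = 1\<^sub>m m" and TS: "T * S = 1\<^sub>m m"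
  shows "matrix_grading G m (\<lambda>g. (\<lambda>x. S * x * T) ` \<A> g)"
proof -
  interpret matrix_grading G m \<A> by fact
  show ?thesis
  proof unfold_locales
    show "finite (carrier G)" by (rule finite_carrier)
  next
    fix g x assume "g \<in> carrier G" "x \<in> (\<lambda>x. S * x * T) ` \<A> g"
    then show "x \<in> carrier_mat m m" using S T component_carrier by auto
  next
    fix g assume "g \<in> carrier G"
    then show "0\<^sub>m m m \<in> (\<lambda>x. S * x * T) ` \<A> g"
      using S T zero_mem by (intro image_eqI[of _ _ "0\<^sub>m m m"]) auto
  next
    fix g x y assume g: "g \<in> carrier G"
      and "x \<in> (\<lambda>x. S * x * T) ` \<A> g" "y \<in> (\<lambda>x. S * x * T) ` \<A> g"
    then obtain a b where ab: "a \<in> \<A> g" "b \<in> \<A> g" "x = S * a * T" "y = S * b * T" by blast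
    have "a \<in> carrier_mat m m" "b \<in> carrier_mat m m" using ab g component_carrier by auto
    then have "x + y = S * (a + b) * T"
      unfolding ab using S T
      by (simp add: mult_add_distrib_mat[of S m m] add_mult_distrib_mat[of _ m m _ T m])
    then show "x + y \<in> (\<lambda>x. S * x * T) ` \<A> g" using add_mem[OF g ab(1,2)] by blast
  next
    fix g x c assume g: "g \<in> carrier G" and "x \<in> (\<lambda>x. S * x * T) ` \<A> g"
    then obtain a where a: "a \<in> \<A> g" "x = S * a * T" by blast
    have "a \<in> carrier_mat m m" using a g component_carrier by auto
    then have "c \<cdot>\<^sub>m x = S * (c \<cdot>\<^sub>m a) * T"
      unfolding a using S T by (simp add: mult_smult_distrib[of S m m] mult_smult_assoc_mat[of _ m m T m])
    then show "c \<cdot>\<^sub>m x \<in> (\<lambda>x. S * x * T) ` \<A> g" using smult_mem[OF g a(1)] by blast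
  next
    fix g h x y assume g: "g \<in> carrier G" and h: "h \<in> carrier G"
      and "x \<in> (\<lambda>x. S * x * T) ` \<A> g" "y \<in> (\<lambda>x. S * x * T) ` \<A> h"
    then obtain a b where ab: "a \<in> \<A> g" "b \<in> \<A> h" "x = S * a * T" "y = S * b * T" by blast
    have c: "a \<in> carrier_mat m m" "b \<in> carrier_mat m m" using ab g h component_carrier by auto
    have "x * y = S * a * (T * S) * b * T"
      unfolding ab using S T c by (simp add: assoc_mult_mat_dim)
    then have "x * y = S * (a * b) * T"
      unfolding TS using S T c by (simp add: assoc_mult_mat_dim)
    then show "x * y \<in> (\<lambda>x. S * x * T) ` \<A> (g \<otimes>\<^bsub>G\<^esub> h)" using mult_mem[OF g h ab(1,2)] by blast
  next
    fix x :: "'k mat" assume x: "x \<in> carrier_mat m m"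
    have "T * x * S \<in> carrier_mat m m" using S T x by simp
    from decomposition[OF this] obtain f where
      f: "\<forall>g\<in>carrier G. f g \<in> \<A> g" "T * x * S = sum_mat m m f (carrier G)" by blast
    have "x = (S * T) * x * (S * T)" unfolding ST using x by simp
    also have "\<dots> = S * (T * x * S) * T"
      using S T x by (simp add: assoc_mult_mat_dim)
    also have "\<dots> = sum_mat m m (\<lambda>g. S * f g * T) (carrier G)"
      unfolding f(2) using f(1) component_carrier finite_carrier S T by (intro mult_sum_mat_mult) auto
    finally have "x = sum_mat m m (\<lambda>g. S * f g * T) (carrier G)" .
    with f(1) show "\<exists>f. (\<forall>g\<in>carrier G. f g \<in> (\<lambda>x. S * x * T) ` \<A> g) \<and> x = sum_mat m m f (carrier G)"
      by (intro exI[of _ "\<lambda>g. S * f g * T"] conjI) auto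
  next
    fix f g assume f: "\<And>g. g \<in> carrier G \<Longrightarrow> f g \<in> (\<lambda>x. S * x * T) ` \<A> g"
      and sum0: "sum_mat m m f (carrier G) = 0\<^sub>m m m" and g: "g \<in> carrier G"
    have "\<forall>g\<in>carrier G. \<exists>a. a \<in> \<A> g \<and> f g = S * a * T" using f by blast
    then obtain a where a: "\<And>g. g \<in> carrier G \<Longrightarrow> a g \<in> \<A> g"
      "\<And>g. g \<in> carrier G \<Longrightarrow> f g = S * a g * T" by metis
    have ac: "a g \<in> carrier_mat m m" if "g \<in> carrier G" for g
      using a(1) component_carrier that by blast
    have a_eq: "a g = T * f g * S" if "g \<in> carrier G" for g
    proof -
      have "a g = (T * S) * a g * (T * S)" unfolding TS using ac[OF that] by simp
      then show ?thesis
        unfolding a(2)[OF that] using S T ac[OF that] by (simp add: assoc_mult_mat_dim)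
    qed
    have "sum_mat m m a (carrier G) = sum_mat m m (\<lambda>g. T * f g * S) (carrier G)"
      by (rule sum_mat_cong) (rule a_eq)
    also have "\<dots> = T * sum_mat m m f (carrier G) * S"
      using finite_carrier S T ac a(2) by (intro mult_sum_mat_mult[symmetric]) auto
    also have "\<dots> = 0\<^sub>m m m" unfolding sum0 using S T by simp
    finally have "a g = 0\<^sub>m m m" using independent[of a] a(1) g by blast
    then show "f g = 0\<^sub>m m m" using a(2)[OF g] S T by simp
  qed
qed

section \<open>Homogeneous elements of rank one\<close>

context matrix_grading
begin

lemma exists_nonzero_homogeneous:
  assumes "x \<in> carrier_mat m m" "L \<in> carrier_mat nr m" "R \<in> carrier_mat m nc"
    "L * x * R \<noteq> 0\<^sub>m nr nc"
  obtains g y where "g \<in> carrier G" "y \<in> \<A> g" "L * y * R \<noteq> 0\<^sub>m nr nc"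
proof -
  from decomposition[OF assms(1)] obtain f where
    f: "\<forall>g\<in>carrier G. f g \<in> \<A> g" "x = sum_mat m m f (carrier G)" by blast
  have "L * x * R = sum_mat nr nc (\<lambda>g. L * f g * R) (carrier G)"
    unfolding f(2) using f(1) component_carrier assms finite_carrier
    by (intro mult_sum_mat_mult) auto
  moreover have "sum_mat nr nc (\<lambda>g. L * f g * R) (carrier G) = 0\<^sub>m nr nc"
    if "\<forall>g\<in>carrier G. L * f g * R = 0\<^sub>m nr nc"
    using that by (intro eq_matI) auto
  ultimately obtain g where "g \<in> carrier G" "L * f g * R \<noteq> 0\<^sub>m nr nc"
    using assms(4) by auto
  with f(1) that show ?thesis by blast
qed

text \<open>The number \<open>r\<close> is the least inner size of a factorization of a nonzero homogeneous element, that
is, the least rank of such an element. If \<open>P\<close> had a kernel, or if a nonzero homogeneous \<open>P Y Q\<close>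
had a singular middle factor \<open>Y\<close>, then a factorization through a smaller size would result.\<close>
lemma minimal_homogeneous_factorization:
  assumes m: "m > 0"
  obtains r P Q g where "r > 0" "P \<in> carrier_mat m r" "Q \<in> carrier_mat r m"
    "g \<in> carrier G" "P * Q \<in> \<A> g" "P * Q \<noteq> 0\<^sub>m m m"
    "\<And>v. v \<in> carrier_vec r \<Longrightarrow> P *\<^sub>v v = 0\<^sub>v m \<Longrightarrow> v = 0\<^sub>v r"
    "\<And>Y h v. Y \<in> carrier_mat r r \<Longrightarrow> h \<in> carrier G \<Longrightarrow> P * Y * Q \<in> \<A> h \<Longrightarrow>
       P * Y * Q \<noteq> 0\<^sub>m m m \<Longrightarrow> v \<in> carrier_vec r \<Longrightarrow> Y *\<^sub>v v = 0\<^sub>v r \<Longrightarrow> v = 0\<^sub>v r"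
proof -
  define factors where "factors = (\<lambda>r. \<exists>P Q g. P \<in> carrier_mat m r \<and> Q \<in> carrier_mat r m \<and>
    g \<in> carrier G \<and> P * Q \<in> \<A> g \<and> P * Q \<noteq> 0\<^sub>m m m)"
  have factorsI: "factors r" if "P \<in> carrier_mat m r" "Q \<in> carrier_mat r m" "g \<in> carrier G"
    "P * Q \<in> \<A> g" "P * Q \<noteq> 0\<^sub>m m m" for r P Q g
    using that unfolding factors_def by blast
  have one0: "1\<^sub>m m \<noteq> (0\<^sub>m m m :: 'k mat)"
  proof
    assume "1\<^sub>m m = (0\<^sub>m m m :: 'k mat)"
    then have "1\<^sub>m m $$ (0, 0) = (0\<^sub>m m m $$ (0, 0) :: 'k)" by simp
    then show False using m by simp
  qed
  have "1\<^sub>m m * 1\<^sub>m m * 1\<^sub>m m \<noteq> (0\<^sub>m m m :: 'k mat)" using one0 by simp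
  then obtain g y where gy: "g \<in> carrier G" "y \<in> \<A> g" "1\<^sub>m m * y * 1\<^sub>m m \<noteq> 0\<^sub>m m m"
    by (rule exists_nonzero_homogeneous[rotated 3]) auto
  have y: "y \<in> carrier_mat m m" using component_carrier gy by blast
  have "factors m" using y gy by (intro factorsI[of y m "1\<^sub>m m" g]) auto
  define r where "r = (LEAST r. factors r)"
  have "factors r" unfolding r_def using \<open>factors m\<close> by (rule LeastI)
  then obtain P Q g where P: "P \<in> carrier_mat m r" and Q: "Q \<in> carrier_mat r m"
    and g: "g \<in> carrier G" and PQ: "P * Q \<in> \<A> g" "P * Q \<noteq> 0\<^sub>m m m"
    unfolding factors_def by blast
  have minimal: "\<not> factors r'" if "r' < r" for r'
    using that unfolding r_def by (rule not_less_Least)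
  have "r > 0"
  proof (rule ccontr)
    assume "\<not> r > 0"
    then have "P * Q = 0\<^sub>m m m" using P Q by (intro eq_matI) (auto simp: scalar_prod_def)
    with PQ show False by simp
  qed
  moreover have "v = 0\<^sub>v r" if v: "v \<in> carrier_vec r" "P *\<^sub>v v = 0\<^sub>v m" for v
  proof (rule ccontr)
    assume "v \<noteq> 0\<^sub>v r"
    from non_injective_factors_through_smaller[OF P v(1) this v(2)] obtain r' P1 P2 where
      r': "r' < r" and P12: "P1 \<in> carrier_mat m r'" "P2 \<in> carrier_mat r' r" "P = P1 * P2" .
    have "P * Q = P1 * (P2 * Q)" using P12 Q by (simp add: assoc_mult_mat_dim)
    then have "factors r'" using P12 Q g PQ by (intro factorsI[of P1 r' "P2 * Q" g]) auto
    with minimal r' show False by blast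
  qed
  moreover have "v = 0\<^sub>v r" if Y: "Y \<in> carrier_mat r r" "h \<in> carrier G" "P * Y * Q \<in> \<A> h"
    "P * Y * Q \<noteq> 0\<^sub>m m m" and v: "v \<in> carrier_vec r" "Y *\<^sub>v v = 0\<^sub>v r" for Y h v
  proof (rule ccontr)
    assume "v \<noteq> 0\<^sub>v r"
    from non_injective_factors_through_smaller[OF Y(1) v(1) this v(2)] obtain r' Y1 Y2 where
      r': "r' < r" and Y12: "Y1 \<in> carrier_mat r r'" "Y2 \<in> carrier_mat r' r" "Y = Y1 * Y2" .
    have "P * Y * Q = (P * Y1) * (Y2 * Q)" using Y12 P Q by (simp add: assoc_mult_mat_dim)
    then have "factors r'" using Y12 P Q Y by (intro factorsI[of "P * Y1" r' "Y2 * Q" h]) auto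
    with minimal r' show False by blast
  qed
  ultimately show ?thesis using P Q g PQ by (intro that) 
qed

end

text \<open>In the notation of the proof, \<open>D x = Q x P\<close> for homogeneous \<open>x\<close> belongs to a graded division
algebra, and it is considered nonzero when \<open>a x a = P (D x) Q\<close> is. The set \<open>T\<close> is the support of that
algebra, in which \<open>D x\<close> has degree \<open>h\<close> if \<open>x\<close> has degree \<open>h g\<inverse>\<close>. With this shift, degrees
multiply along \<open>D x D y = D (x a y)\<close>, since the factor \<open>a\<close> of degree \<open>g\<close> cancels the \<open>g\<inverse>\<close> on its left.\<close>
lemma homogeneous_rank_one_exists:
  fixes \<A> :: "'g \<Rightarrow> 'k::alg_closed_field mat set"
  assumes "matrix_grading G m \<A>" and cyc: "cyclic_group G" and m: "m > 0"
  obtains g p \<psi> where "g \<in> carrier G" "p \<in> carrier_vec m" "p \<noteq> 0\<^sub>v m"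
    "mat m m (\<lambda>(i, j). p $ i * \<psi> j) \<in> \<A> g" "mat m m (\<lambda>(i, j). p $ i * \<psi> j) \<noteq> 0\<^sub>m m m"
proof -
  interpret matrix_grading G m \<A> by fact
  obtain r P Q g where r: "r > 0" and P: "P \<in> carrier_mat m r" and Q: "Q \<in> carrier_mat r m"
    and g: "g \<in> carrier G" and PQ: "P * Q \<in> \<A> g" "P * Q \<noteq> 0\<^sub>m m m"
    and P_inj: "\<And>v. v \<in> carrier_vec r \<Longrightarrow> P *\<^sub>v v = 0\<^sub>v m \<Longrightarrow> v = 0\<^sub>v r"
    and inj: "\<And>Y h v. Y \<in> carrier_mat r r \<Longrightarrow> h \<in> carrier G \<Longrightarrow> P * Y * Q \<in> \<A> h \<Longrightarrow>
       P * Y * Q \<noteq> 0\<^sub>m m m \<Longrightarrow> v \<in> carrier_vec r \<Longrightarrow> Y *\<^sub>v v = 0\<^sub>v r \<Longrightarrow> v = 0\<^sub>v r"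
    using minimal_homogeneous_factorization[OF m] by metis
  define a where "a = P * Q"
  define D where "D = (\<lambda>x. Q * x * P)"
  have a: "a \<in> carrier_mat m m" using P Q by (simp add: a_def)
  have D: "D x \<in> carrier_mat r r" if "x \<in> carrier_mat m m" for x
    using that P Q by (simp add: D_def)
  have D_mult: "D x * D y = D (x * a * y)" if "x \<in> carrier_mat m m" "y \<in> carrier_mat m m" for x y
    using that P Q by (simp add: D_def a_def assoc_mult_mat_dim)
  have PDQ: "P * D x * Q = a * x * a" if "x \<in> carrier_mat m m" for x
    using that P Q by (simp add: D_def a_def assoc_mult_mat_dim)
  have axa: "a * x * a \<in> \<A> (g \<otimes>\<^bsub>G\<^esub> h \<otimes>\<^bsub>G\<^esub> g)" if "h \<in> carrier G" "x \<in> \<A> h" for h x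
    unfolding a_def using that g PQ by (intro mult_mem) auto
  have D_inj: "v = 0\<^sub>v r" if "h \<in> carrier G" "x \<in> \<A> h" "a * x * a \<noteq> 0\<^sub>m m m"
    "v \<in> carrier_vec r" "D x *\<^sub>v v = 0\<^sub>v r" for h x v
  proof -
    have x: "x \<in> carrier_mat m m" using that component_carrier by blast
    have "g \<otimes>\<^bsub>G\<^esub> h \<otimes>\<^bsub>G\<^esub> g \<in> carrier G" using that(1) g by simp
    from inj[OF D[OF x] this, unfolded PDQ[OF x], OF axa[OF that(1,2)] that(3-5)] show ?thesis .
  qed
  have DQ: "D x * Q = 0\<^sub>m r m" if "x \<in> carrier_mat m m" "a * x * a = 0\<^sub>m m m" for x
    using that P Q D[OF that(1)] P_inj PDQ[OF that(1)]
    by (intro injective_mat_mult_eq_zero[OF P]) (auto simp: assoc_mult_mat_dim)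

  \<comment> \<open>The support, with degrees shifted as above.\<close>
  define T where "T = {h \<in> carrier G. \<exists>x\<in>\<A> (h \<otimes>\<^bsub>G\<^esub> inv\<^bsub>G\<^esub> g). a * x * a \<noteq> 0\<^sub>m m m}"
  have in_T: "h \<otimes>\<^bsub>G\<^esub> g \<in> T" if "h \<in> carrier G" "x \<in> \<A> h" "a * x * a \<noteq> 0\<^sub>m m m" for h x
  proof -
    have "h \<otimes>\<^bsub>G\<^esub> g \<otimes>\<^bsub>G\<^esub> inv\<^bsub>G\<^esub> g = h" using that g by (simp add: m_assoc)
    with that g show ?thesis unfolding T_def by auto
  qed
  have shift: "h \<otimes>\<^bsub>G\<^esub> inv\<^bsub>G\<^esub> g \<otimes>\<^bsub>G\<^esub> g \<otimes>\<^bsub>G\<^esub> (h' \<otimes>\<^bsub>G\<^esub> inv\<^bsub>G\<^esub> g) = h \<otimes>\<^bsub>G\<^esub> h' \<otimes>\<^bsub>G\<^esub> inv\<^bsub>G\<^esub> g"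
    if "h \<in> carrier G" "h' \<in> carrier G" for h h'
    using that g by (simp add: m_assoc)
  have xay: "x * a * y \<in> \<A> (h \<otimes>\<^bsub>G\<^esub> h' \<otimes>\<^bsub>G\<^esub> inv\<^bsub>G\<^esub> g)" "a * (x * a * y) * a \<noteq> 0\<^sub>m m m"
    if "h \<in> T" "h' \<in> T" "x \<in> \<A> (h \<otimes>\<^bsub>G\<^esub> inv\<^bsub>G\<^esub> g)" "y \<in> \<A> (h' \<otimes>\<^bsub>G\<^esub> inv\<^bsub>G\<^esub> g)"
      "a * x * a \<noteq> 0\<^sub>m m m" "a * y * a \<noteq> 0\<^sub>m m m" for h h' x y
  proof -
    have hG: "h \<in> carrier G" "h' \<in> carrier G" using that by (auto simp: T_def)
    have sG: "h \<otimes>\<^bsub>G\<^esub> inv\<^bsub>G\<^esub> g \<in> carrier G" "h' \<otimes>\<^bsub>G\<^esub> inv\<^bsub>G\<^esub> g \<in> carrier G" using hG g by auto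
    have x: "x \<in> carrier_mat m m" and y: "y \<in> carrier_mat m m"
      using that sG component_carrier by blast+
    have "x * a * y \<in> \<A> (h \<otimes>\<^bsub>G\<^esub> inv\<^bsub>G\<^esub> g \<otimes>\<^bsub>G\<^esub> g \<otimes>\<^bsub>G\<^esub> (h' \<otimes>\<^bsub>G\<^esub> inv\<^bsub>G\<^esub> g))"
      using that sG g PQ unfolding a_def by (intro mult_mem) auto
    then show "x * a * y \<in> \<A> (h \<otimes>\<^bsub>G\<^esub> h' \<otimes>\<^bsub>G\<^esub> inv\<^bsub>G\<^esub> g)" unfolding shift[OF hG] .
    show "a * (x * a * y) * a \<noteq> 0\<^sub>m m m"
    proof
      assume zero: "a * (x * a * y) * a = 0\<^sub>m m m"
      have xy: "x * a * y \<in> carrier_mat m m" using x y a by simp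
      have "D x * (D y * Q) = D (x * a * y) * Q"
        using D[OF x] D[OF y] Q by (simp add: D_mult[OF x y, symmetric] assoc_mult_mat_dim)
      also have "\<dots> = 0\<^sub>m r m" by (rule DQ[OF xy zero])
      finally have DDQ: "D x * (D y * Q) = 0\<^sub>m r m" .
      have "D y * Q = 0\<^sub>m r m"
        by (rule injective_mat_mult_eq_zero[OF D[OF x] mult_carrier_mat[OF D[OF y] Q] _ DDQ])
           (rule D_inj[OF sG(1) that(3,5)])
      then have "Q = 0\<^sub>m r m"
        by (rule injective_mat_mult_eq_zero[OF D[OF y] Q, rotated])
           (rule D_inj[OF sG(2) that(4,6)])
      then have "P * Q = 0\<^sub>m m m" using P by simp
      with PQ show False by simp
    qed
  qed
  obtain c where c: "c \<in> T" and T_powers: "\<And>h. h \<in> T \<Longrightarrow> \<exists>j::nat. h = c [^]\<^bsub>G\<^esub> Suc j"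
  proof (rule cyclic_subsemigroup_has_generator[OF group_axioms cyc finite_carrier, of T])
    show "T \<subseteq> carrier G" by (auto simp: T_def)
    obtain x where "x \<in> carrier_mat m m" "a * x * a \<noteq> 0\<^sub>m m m"
      using exists_sandwich_nonzero[OF a] PQ(2) unfolding a_def by blast
    from exists_nonzero_homogeneous[OF this(1) a a this(2)] in_T show "T \<noteq> {}" by blast
    show "h \<otimes>\<^bsub>G\<^esub> h' \<in> T" if "h \<in> T" "h' \<in> T" for h h'
      using that xay[OF that] unfolding T_def by blast
  qed blast
  obtain x0 where x0: "x0 \<in> \<A> (c \<otimes>\<^bsub>G\<^esub> inv\<^bsub>G\<^esub> g)" "a * x0 * a \<noteq> 0\<^sub>m m m"
    using c unfolding T_def by blast
  have cG: "c \<in> carrier G" using c by (simp add: T_def)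
  have cgG: "c \<otimes>\<^bsub>G\<^esub> inv\<^bsub>G\<^esub> g \<in> carrier G" using cG g by simp
  have x0c: "x0 \<in> carrier_mat m m" using component_carrier[OF cgG] x0 by blast
  have C: "D x0 \<in> carrier_mat r r" by (rule D[OF x0c])

  \<comment> \<open>An eigenvector of \<open>D x0\<close>, from the pencil of \<open>D x0\<close> and the identity matrix.\<close>
  obtain \<mu> w where w: "w \<in> carrier_vec r" "w \<noteq> 0\<^sub>v r" and Cw: "D x0 *\<^sub>v w = \<mu> \<cdot>\<^sub>v w"
  proof (rule pencil_has_kernel[OF r one_carrier_mat C])
    fix \<mu> v assume v: "v \<in> carrier_vec r" "v \<noteq> 0\<^sub>v r" "(D x0 - \<mu> \<cdot>\<^sub>m 1\<^sub>m r) *\<^sub>v v = 0\<^sub>v r"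
    have "D x0 *\<^sub>v v = \<mu> \<cdot>\<^sub>v v" using pencil_kernel_iff[OF one_carrier_mat C v(1)] v by simp
    with v that show thesis by blast
  qed simp
  have \<mu>: "\<mu> \<noteq> 0"
  proof
    assume "\<mu> = 0"
    then have "D x0 *\<^sub>v w = 0\<^sub>v r" using Cw w by auto
    with D_inj[OF cgG x0] w show False by blast
  qed

  \<comment> \<open>Injectivity of \<open>P\<close> gives \<open>D x * Q = 0\<close>, and \<open>w\<close>, a multiple of \<open>D x0 w\<close>, lies in the image of \<open>Q\<close>.\<close>
  have kill: "D x *\<^sub>v w = 0\<^sub>v r" if x: "x \<in> carrier_mat m m" and "a * x * a = 0\<^sub>m m m" for x
  proof -
    have "\<mu> \<cdot>\<^sub>v (D x *\<^sub>v w) = D x *\<^sub>v (D x0 *\<^sub>v w)"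
      unfolding Cw using D[OF x] w by (simp add: mult_mat_vec)
    also have "\<dots> = (D x * Q) *\<^sub>v ((x0 * P) *\<^sub>v w)"
      using D[OF x] w x0c P Q by (simp add: D_def assoc_mult_mat_dim assoc_mult_mat_vec_dim)
    also have "\<dots> = 0\<^sub>v r" unfolding DQ[OF that] using x0c P w by auto
    finally have "(1 / \<mu>) \<cdot>\<^sub>v (\<mu> \<cdot>\<^sub>v (D x *\<^sub>v w)) = (1 / \<mu>) \<cdot>\<^sub>v 0\<^sub>v r" by simp
    moreover have "(1 / \<mu>) \<cdot>\<^sub>v 0\<^sub>v r = 0\<^sub>v r" by (intro eq_vecI) auto
    ultimately show ?thesis using \<mu> by (simp add: smult_smult_assoc)
  qed

  \<comment> \<open>The element of degree \<open>c\<^sup>j\<^sup>+\<^sup>1\<close> of the division algebra is \<open>(D x0)\<^sup>j\<^sup>+\<^sup>1\<close>; of it only the effect on \<open>w\<close> matters.\<close>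
  have power: "\<exists>x\<in>\<A> (c [^]\<^bsub>G\<^esub> Suc j \<otimes>\<^bsub>G\<^esub> inv\<^bsub>G\<^esub> g). a * x * a \<noteq> 0\<^sub>m m m \<and>
      D x *\<^sub>v w = \<mu> ^ Suc j \<cdot>\<^sub>v w" and power_T: "c [^]\<^bsub>G\<^esub> Suc j \<in> T" for j
  proof (induction j)
    case 0
    { case 1 show ?case using x0 Cw cG by auto }
    { case 2 show ?case using c cG by simp }
  next
    case (Suc j)
    from Suc.IH obtain x where x: "x \<in> \<A> (c [^]\<^bsub>G\<^esub> Suc j \<otimes>\<^bsub>G\<^esub> inv\<^bsub>G\<^esub> g)" "a * x * a \<noteq> 0\<^sub>m m m"
      "D x *\<^sub>v w = \<mu> ^ Suc j \<cdot>\<^sub>v w" by blast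
    have "c [^]\<^bsub>G\<^esub> Suc j \<otimes>\<^bsub>G\<^esub> inv\<^bsub>G\<^esub> g \<in> carrier G" using cG g by simp
    with x have xc: "x \<in> carrier_mat m m" using component_carrier by blast
    note new = xay[OF Suc.IH(2) c x(1) x0(1) x(2) x0(2)]
    have step: "c [^]\<^bsub>G\<^esub> Suc (Suc j) = c [^]\<^bsub>G\<^esub> Suc j \<otimes>\<^bsub>G\<^esub> c" by simp
    have "D (x * a * x0) *\<^sub>v w = D x *\<^sub>v (D x0 *\<^sub>v w)"
      unfolding D_mult[OF xc x0c, symmetric] using D[OF xc] C w by (simp add: assoc_mult_mat_vec_dim)
    also have "\<dots> = \<mu> \<cdot>\<^sub>v (\<mu> ^ Suc j \<cdot>\<^sub>v w)"
      unfolding Cw x(3)[symmetric] using D[OF xc] w by (simp add: mult_mat_vec)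
    finally have ev: "D (x * a * x0) *\<^sub>v w = \<mu> ^ Suc (Suc j) \<cdot>\<^sub>v w" by (simp add: smult_smult_assoc)
    { case 1 show ?case using new ev unfolding step by blast }
    { case 2 show ?case using new cG unfolding step T_def by auto }
  qed

  \<comment> \<open>A nonzero \<open>D x\<close> is proportional to the power of \<open>D x0\<close> in its degree.\<close>
  have homogeneous_eigen: "\<exists>\<nu>. D x *\<^sub>v w = \<nu> \<cdot>\<^sub>v w" if h: "h \<in> carrier G" and x: "x \<in> \<A> h" for h x
  proof -
    have xc: "x \<in> carrier_mat m m" using component_carrier[OF h x] .
    show ?thesis
    proof (cases "a * x * a = 0\<^sub>m m m")
      case True
      then have "D x *\<^sub>v w = 0 \<cdot>\<^sub>v w" using kill[OF xc] w by auto
      then show ?thesis by blast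
    next
      case False
      obtain j where j: "h \<otimes>\<^bsub>G\<^esub> g = c [^]\<^bsub>G\<^esub> Suc j" using T_powers[OF in_T[OF h x False]] by blast
      have hj: "c [^]\<^bsub>G\<^esub> Suc j \<otimes>\<^bsub>G\<^esub> inv\<^bsub>G\<^esub> g = h"
        unfolding j[symmetric] using h g by (simp add: m_assoc)
      obtain y where y: "y \<in> \<A> h" "a * y * a \<noteq> 0\<^sub>m m m" "D y *\<^sub>v w = \<mu> ^ Suc j \<cdot>\<^sub>v w"
        using power[of j] unfolding hj by blast
      have yc: "y \<in> carrier_mat m m" using component_carrier[OF h y(1)] .
      obtain \<kappa> v where v: "v \<in> carrier_vec r" "v \<noteq> 0\<^sub>v r" "(D x - \<kappa> \<cdot>\<^sub>m D y) *\<^sub>v v = 0\<^sub>v r"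
        using pencil_has_kernel[OF r D[OF yc] D[OF xc]] D_inj[OF h y(1,2)] by blast
      define z where "z = x - \<kappa> \<cdot>\<^sub>m y"
      have z: "z \<in> \<A> h" unfolding z_def using h x y by (intro minus_mem smult_mem)
      have zc: "z \<in> carrier_mat m m" using component_carrier[OF h z] .
      have Dz: "D z = D x - \<kappa> \<cdot>\<^sub>m D y"
        unfolding D_def z_def using xc yc P Q
        by (simp add: mult_minus_distrib_mat[of Q r m] minus_mult_distrib_mat[of _ r m _ P r]
            mult_smult_distrib[of Q r m] mult_smult_assoc_mat[of _ r m P r])
      have "a * z * a = 0\<^sub>m m m" using D_inj[OF h z] v unfolding Dz by blast
      then have "D z *\<^sub>v w = 0\<^sub>v r" by (rule kill[OF zc])
      then have "D x *\<^sub>v w = \<kappa> \<cdot>\<^sub>v (D y *\<^sub>v w)"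
        unfolding Dz using pencil_kernel_iff[OF D[OF yc] D[OF xc] w(1)] by simp
      then have "D x *\<^sub>v w = (\<kappa> * \<mu> ^ Suc j) \<cdot>\<^sub>v w" unfolding y(3) by (simp add: smult_smult_assoc)
      then show ?thesis by blast
    qed
  qed

  have eigen: "\<exists>\<nu>. D x *\<^sub>v w = \<nu> \<cdot>\<^sub>v w" if x: "x \<in> carrier_mat m m" for x
  proof -
    from decomposition[OF x] obtain f where
      f: "\<And>h. h \<in> carrier G \<Longrightarrow> f h \<in> \<A> h" "x = sum_mat m m f (carrier G)" by blast
    have fc: "f h \<in> carrier_mat m m" if "h \<in> carrier G" for h using f(1) component_carrier that by blast
    have "\<forall>h\<in>carrier G. \<exists>\<nu>. D (f h) *\<^sub>v w = \<nu> \<cdot>\<^sub>v w" using homogeneous_eigen f(1) by blast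
    then obtain \<nu> where \<nu>: "\<And>h. h \<in> carrier G \<Longrightarrow> D (f h) *\<^sub>v w = \<nu> h \<cdot>\<^sub>v w" by metis
    have Dx: "D x = sum_mat r r (\<lambda>h. D (f h)) (carrier G)"
      unfolding D_def f(2) using fc P Q finite_carrier by (intro mult_sum_mat_mult) auto
    have "D x *\<^sub>v w = (\<Sum>h\<in>carrier G. \<nu> h) \<cdot>\<^sub>v w"
    proof (rule eq_vecI)
      fix i assume "i < dim_vec ((\<Sum>h\<in>carrier G. \<nu> h) \<cdot>\<^sub>v w)"
      then have i: "i < r" using w by simp
      have "(D x *\<^sub>v w) $ i = (\<Sum>h\<in>carrier G. (D (f h) *\<^sub>v w) $ i)"
        unfolding Dx using D fc w i by (intro sum_mat_mult_vec_index) auto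
      also have "\<dots> = (\<Sum>h\<in>carrier G. \<nu> h * w $ i)"
        using \<nu> w i by (intro sum.cong) auto
      finally show "(D x *\<^sub>v w) $ i = ((\<Sum>h\<in>carrier G. \<nu> h) \<cdot>\<^sub>v w) $ i"
        using i w by (simp add: sum_distrib_right)
    qed (use w D[OF x] in auto)
    then show ?thesis by blast
  qed

  define p where "p = P *\<^sub>v w"
  have p: "p \<in> carrier_vec m" using P w by (simp add: p_def)
  have p0: "p \<noteq> 0\<^sub>v m" using P_inj w unfolding p_def by blast
  have "\<exists>\<nu>. Q *\<^sub>v u = \<nu> \<cdot>\<^sub>v w" if u: "u \<in> carrier_vec m" for u
  proof -
    obtain x where x: "x \<in> carrier_mat m m" "x *\<^sub>v p = u" using exists_mat_mapping_to[OF p p0 u] .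
    have "Q *\<^sub>v u = D x *\<^sub>v w"
      unfolding x(2)[symmetric] p_def D_def using x(1) P Q w by (simp add: assoc_mult_mat_vec_dim)
    then show ?thesis using eigen[OF x(1)] by simp
  qed
  then have "\<forall>j. \<exists>\<nu>. Q *\<^sub>v unit_vec m j = \<nu> \<cdot>\<^sub>v w" by simp
  then obtain \<psi> where \<psi>: "\<And>j. Q *\<^sub>v unit_vec m j = \<psi> j \<cdot>\<^sub>v w" by metis
  have "a = mat m m (\<lambda>(i, j). p $ i * \<psi> j)"
  proof (rule mat_col_eqI)
    fix j assume "j < dim_col (mat m m (\<lambda>(i, j). p $ i * \<psi> j))"
    then have j: "j < m" by simp
    have "col a j = a *\<^sub>v unit_vec m j" using a j by (intro eq_vecI) auto
    also have "\<dots> = P *\<^sub>v (Q *\<^sub>v unit_vec m j)" unfolding a_def using P Q by (simp add: assoc_mult_mat_vec_dim)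
    also have "\<dots> = \<psi> j \<cdot>\<^sub>v p" unfolding \<psi> p_def using P w by (simp add: mult_mat_vec)
    also have "\<dots> = col (mat m m (\<lambda>(i, j). p $ i * \<psi> j)) j"
      using j p by (intro eq_vecI) auto
    finally show "col a j = col (mat m m (\<lambda>(i, j). p $ i * \<psi> j)) j" .
  qed (use a in auto)
  with PQ g p p0 show ?thesis by (intro that[of g p \<psi>]) (auto simp: a_def)
qed

section \<open>A homogeneous basis of the column space\<close>

context matrix_grading
begin

lemma sum_shift:
  fixes \<phi> :: "'g \<Rightarrow> 'a::comm_monoid_add"
  assumes "d \<in> carrier G"
  shows "(\<Sum>l\<in>carrier G. \<phi> (l \<otimes> inv d)) = (\<Sum>h\<in>carrier G. \<phi> h)"
  by (rule sum.reindex_bij_witness[of _ "\<lambda>h. h \<otimes> d" "\<lambda>l. l \<otimes> inv d"])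
     (use assms in \<open>auto simp: m_assoc\<close>)

lemma shifted_mult_mem:
  assumes "d \<in> carrier G" "l \<in> carrier G" "\<And>h. h \<in> carrier G \<Longrightarrow> f h \<in> \<A> h" "x \<in> \<A> d"
  shows "f (l \<otimes> inv d) * x \<in> \<A> l"
proof -
  have "f (l \<otimes> inv d) * x \<in> \<A> (l \<otimes> inv d \<otimes> d)" using assms by (intro mult_mem) auto
  moreover have "l \<otimes> inv d \<otimes> d = l" using assms by (simp add: m_assoc)
  ultimately show ?thesis by simp
qed

text \<open>The products \<open>f\<^sub>h a\<close> are homogeneous of the distinct degrees \<open>h g\<close>, and their sum is the product of
\<open>a\<close> with a matrix that kills \<open>p\<close>, hence zero. So each \<open>f\<^sub>h a = (f\<^sub>h p) \<psi>\<^sup>T\<close> is zero, and since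
\<open>\<psi> \<noteq> 0\<close> also \<open>f\<^sub>h p = 0\<close>. In other words the subspaces \<open>A\<^sub>h p\<close> of \<open>k\<^sup>m\<close> are independent.\<close>
lemma rank_one_annihilator_graded:
  assumes g: "g \<in> carrier G" and p: "p \<in> carrier_vec m"
    and a: "mat m m (\<lambda>(i, j). p $ i * \<psi> j) \<in> \<A> g" "mat m m (\<lambda>(i, j). p $ i * \<psi> j) \<noteq> 0\<^sub>m m m"
    and f: "\<And>h. h \<in> carrier G \<Longrightarrow> f h \<in> \<A> h"
    and zero: "sum_mat m m f (carrier G) *\<^sub>v p = 0\<^sub>v m" and h: "h \<in> carrier G"
  shows "f h *\<^sub>v p = 0\<^sub>v m"
proof -
  define a where "a = mat m m (\<lambda>(i, j). p $ i * \<psi> j)"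
  have fc: "f h \<in> carrier_mat m m" if "h \<in> carrier G" for h using f component_carrier that by blast
  have fa: "(f h * a) $$ (i, j) = (f h *\<^sub>v p) $ i * \<psi> j" if "h \<in> carrier G" "i < m" "j < m" for h i j
    unfolding a_def mult_outer_product[OF fc[OF that(1)] p] using that by simp
  obtain j where j: "j < m" "\<psi> j \<noteq> 0"
  proof (rule ccontr)
    assume "\<not> thesis"
    with that have "a = 0\<^sub>m m m" unfolding a_def by (intro eq_matI) auto
    with a(2) show False by (simp add: a_def)
  qed
  have "sum_mat m m (\<lambda>l. f (l \<otimes> inv g) * a) (carrier G) = 0\<^sub>m m m"
  proof (rule eq_matI)
    fix i j assume "i < dim_row (0\<^sub>m m m :: 'k mat)" "j < dim_col (0\<^sub>m m m :: 'k mat)"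
    then have i: "i < m" and j: "j < m" by auto
    have "sum_mat m m (\<lambda>l. f (l \<otimes> inv g) * a) (carrier G) $$ (i, j)
        = (\<Sum>h\<in>carrier G. (f h * a) $$ (i, j))"
      using i j sum_shift[OF g, of "\<lambda>h. (f h * a) $$ (i, j)"] by simp
    also have "\<dots> = (\<Sum>h\<in>carrier G. (f h *\<^sub>v p) $ i) * \<psi> j"
      using fa i j by (simp add: sum_distrib_right)
    also have "(\<Sum>h\<in>carrier G. (f h *\<^sub>v p) $ i) = (sum_mat m m f (carrier G) *\<^sub>v p) $ i"
      using fc p i by (intro sum_mat_mult_vec_index[symmetric]) auto
    also have "\<dots> * \<psi> j = 0" unfolding zero using i by simp
    finally show "sum_mat m m (\<lambda>l. f (l \<otimes> inv g) * a) (carrier G) $$ (i, j) = 0\<^sub>m m m $$ (i, j)"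
      using i j by simp
  qed auto
  from independent[OF _ this] have "f (h \<otimes> g \<otimes> inv g) * a = 0\<^sub>m m m"
    using shifted_mult_mem[OF g _ f] a(1) g h by (simp add: a_def)
  moreover have "h \<otimes> g \<otimes> inv g = h" using g h by (simp add: m_assoc)
  ultimately have fh0: "f h * a = 0\<^sub>m m m" by simp
  show ?thesis
  proof (rule eq_vecI)
    fix i assume "i < dim_vec (0\<^sub>v m :: 'k vec)"
    then have i: "i < m" by simp
    then have "(f h *\<^sub>v p) $ i * \<psi> j = 0" using fa[OF h i j(1)] j fh0 by simp
    then show "(f h *\<^sub>v p) $ i = 0\<^sub>v m $ i" using j i by simp
  qed (use fc[OF h] in simp)
qed

text \<open>The homogeneous vectors \<open>x p\<close> span \<open>k\<^sup>m\<close>, so the columns of an invertible matrix can be exchanged for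
homogeneous ones, one by one. The column to be replaced is a sum of homogeneous vectors \<open>f\<^sub>h p\<close>, and
by Cramer's rule the determinant after replacement is a coordinate of \<open>T\<inverse> f\<^sub>h p\<close> times \<open>det T\<close>.
These coordinates add up to 1 over all \<open>h\<close>, so one of them is nonzero.\<close>
lemma homogeneous_columns:
  assumes p: "p \<in> carrier_vec m" "p \<noteq> 0\<^sub>v m" and "n \<le> m"
  shows "\<exists>T. T \<in> carrier_mat m m \<and> det T \<noteq> 0 \<and>
    (\<forall>k<n. \<exists>d\<in>carrier G. \<exists>x\<in>\<A> d. col T k = x *\<^sub>v p)"
  using \<open>n \<le> m\<close>
proof (induction n)
  case 0
  show ?case by (intro exI[of _ "1\<^sub>m m"]) auto
next
  case (Suc n)
  then obtain T where T: "T \<in> carrier_mat m m" "det T \<noteq> 0"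
    and cols: "\<forall>k<n. \<exists>d\<in>carrier G. \<exists>x\<in>\<A> d. col T k = x *\<^sub>v p" by auto
  have n: "n < m" using Suc.prems by simp
  from det_non_zero_imp_unit[OF T, of "()"] obtain S where
    S: "S \<in> carrier_mat m m" "S * T = 1\<^sub>m m" "T * S = 1\<^sub>m m"
    unfolding Units_def ring_mat_simps by auto
  obtain y where y: "y \<in> carrier_mat m m" "y *\<^sub>v p = col T n"
    using exists_mat_mapping_to[OF p col_carrier_vec[OF n T(1)]] .
  from decomposition[OF y(1)] obtain f where
    f: "\<forall>h\<in>carrier G. f h \<in> \<A> h" "y = sum_mat m m f (carrier G)" by blast
  have fc: "f h \<in> carrier_mat m m" if "h \<in> carrier G" for h using f component_carrier that by blast
  have "S * y = sum_mat m m (\<lambda>h. S * f h * 1\<^sub>m m) (carrier G)"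
    using mult_sum_mat_mult[OF finite_carrier fc S(1) one_carrier_mat] S y f(2) by simp
  also have "\<dots> = sum_mat m m (\<lambda>h. S * f h) (carrier G)"
    by (rule sum_mat_cong) (rule right_mult_one_mat[OF mult_carrier_mat[OF S(1) fc]])
  finally have Sy: "S * y = sum_mat m m (\<lambda>h. S * f h) (carrier G)" .
  have "(\<Sum>h\<in>carrier G. ((S * f h) *\<^sub>v p) $ n) = ((S * y) *\<^sub>v p) $ n"
    unfolding Sy using S fc p n by (intro sum_mat_mult_vec_index[symmetric]) auto
  also have "(S * y) *\<^sub>v p = S *\<^sub>v col T n"
    using S y p by (simp add: assoc_mult_mat_vec_dim)
  also have "\<dots> = col (S * T) n" using S(1) T(1) n by (intro eq_vecI) auto
  also have "\<dots> $ n = 1" unfolding S(2) using n by simp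
  finally have "(\<Sum>h\<in>carrier G. ((S * f h) *\<^sub>v p) $ n) \<noteq> 0" by simp
  then obtain h where h: "h \<in> carrier G" "((S * f h) *\<^sub>v p) $ n \<noteq> 0"
    by (meson sum.neutral)
  define T' where "T' = replace_col T (T *\<^sub>v ((S * f h) *\<^sub>v p)) n"
  have T': "T' \<in> carrier_mat m m" using T by (simp add: T'_def replace_col_def)
  have "T *\<^sub>v ((S * f h) *\<^sub>v p) = (T * S) *\<^sub>v (f h *\<^sub>v p)"
    using T(1) S(1) fc[OF h(1)] p(1) by (simp add: assoc_mult_mat_vec_dim)
  also have "\<dots> = f h *\<^sub>v p" unfolding S(3) using fc[OF h(1)] p by simp
  finally have fh: "T *\<^sub>v ((S * f h) *\<^sub>v p) = f h *\<^sub>v p" .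
  have "det T' = ((S * f h) *\<^sub>v p) $ n * det T"
    unfolding T'_def using S fc[OF h(1)] p T n by (intro cramer_lemma_mat) auto
  then have "det T' \<noteq> 0" using h T by simp
  moreover have "\<exists>d\<in>carrier G. \<exists>x\<in>\<A> d. col T' k = x *\<^sub>v p" if k: "k < Suc n" for k
  proof (cases "k = n")
    case True
    have "col T' n = f h *\<^sub>v p"
      unfolding T'_def fh using T n fc[OF h(1)] by (intro eq_vecI) (auto simp: replace_col_def)
    then show ?thesis using True h f by blast
  next
    case False
    then have "col T' k = col T k"
      unfolding T'_def using T n k by (intro eq_vecI) (auto simp: replace_col_def)
    then show ?thesis using cols k False by simp
  qed
  ultimately show ?case using T' by blast
qed

text \<open>A matrix that raises the degree of each vector of a homogeneous basis by \<open>s\<close> is homogeneous of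
degree \<open>s\<close>. For its components \<open>f\<^sub>h\<close> of other degrees \<open>h\<close> map the \<open>k\<close>-th basis vector into
degree \<open>h d\<^sub>k \<noteq> s d\<^sub>k\<close>, where the image under the whole matrix has no component; so these \<open>f\<^sub>h\<close> vanish on
a basis.\<close>
lemma homogeneous_if_shifts_basis:
  assumes p: "p \<in> carrier_vec m"
    and annihilator: "\<And>f h. (\<And>h. h \<in> carrier G \<Longrightarrow> f h \<in> \<A> h) \<Longrightarrow>
      sum_mat m m f (carrier G) *\<^sub>v p = 0\<^sub>v m \<Longrightarrow> h \<in> carrier G \<Longrightarrow> f h *\<^sub>v p = 0\<^sub>v m"
    and T: "T \<in> carrier_mat m m" "S \<in> carrier_mat m m" "T * S = 1\<^sub>m m"
    and d: "\<And>k. k < m \<Longrightarrow> d k \<in> carrier G"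
    and x: "\<And>k. k < m \<Longrightarrow> x k \<in> \<A> (d k)" "\<And>k. k < m \<Longrightarrow> col T k = x k *\<^sub>v p"
    and E: "E \<in> carrier_mat m m" and s: "s \<in> carrier G"
    and z: "\<And>k. k < m \<Longrightarrow> z k \<in> \<A> (s \<otimes> d k)" "\<And>k. k < m \<Longrightarrow> E *\<^sub>v col T k = z k *\<^sub>v p"
  shows "E \<in> \<A> s"
proof -
  from decomposition[OF E] obtain f where
    f: "\<And>h. h \<in> carrier G \<Longrightarrow> f h \<in> \<A> h" "E = sum_mat m m f (carrier G)" by blast
  have fc: "f h \<in> carrier_mat m m" if "h \<in> carrier G" for h using f component_carrier that by blast
  have xc: "x k \<in> carrier_mat m m" if "k < m" for k using x(1) d component_carrier that by blast
  have zc: "z k \<in> carrier_mat m m" if "k < m" for k using z(1) d s component_carrier that by blast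
  have fT: "f h *\<^sub>v col T k = 0\<^sub>v m" if h: "h \<in> carrier G" "h \<noteq> s" and k: "k < m" for h k
  proof -
    \<comment> \<open>The component in degree \<open>l\<close> of \<open>E x\<^sub>k - z\<^sub>k\<close>, which kills \<open>p\<close>.\<close>
    define F where "F = (\<lambda>l. f (l \<otimes> inv d k) * x k - (if l = s \<otimes> d k then z k else 0\<^sub>m m m))"
    have F: "F l \<in> \<A> l" if l: "l \<in> carrier G" for l
      unfolding F_def using l d[OF k] x(1)[OF k] z(1)[OF k] zero_mem[OF l]
      by (intro minus_mem shifted_mult_mem f(1)) auto
    have Fc: "F l \<in> carrier_mat m m" if "l \<in> carrier G" for l using F component_carrier that by blast
    have F_vec: "(F l *\<^sub>v p) $ i
        = (f (l \<otimes> inv d k) *\<^sub>v col T k) $ i - (if l = s \<otimes> d k then (z k *\<^sub>v p) $ i else 0)"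
      if l: "l \<in> carrier G" and i: "i < m" for l i
    proof -
      have lc: "f (l \<otimes> inv d k) \<in> carrier_mat m m" using l d[OF k] by (intro fc) simp
      have "F l *\<^sub>v p = (f (l \<otimes> inv d k) * x k) *\<^sub>v p
          - (if l = s \<otimes> d k then z k else 0\<^sub>m m m) *\<^sub>v p"
        unfolding F_def using lc xc[OF k] zc[OF k] p by (intro minus_mult_distrib_mat_vec[of _ m m]) auto
      also have "(f (l \<otimes> inv d k) * x k) *\<^sub>v p = f (l \<otimes> inv d k) *\<^sub>v col T k"
        unfolding x(2)[OF k] using lc xc[OF k] p by (simp add: assoc_mult_mat_vec_dim)
      finally show ?thesis using lc zc[OF k] p i by auto
    qed
    have "sum_mat m m F (carrier G) *\<^sub>v p = 0\<^sub>v m"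
    proof (rule eq_vecI)
      fix i assume "i < dim_vec (0\<^sub>v m :: 'k vec)"
      then have i: "i < m" by simp
      have "(sum_mat m m F (carrier G) *\<^sub>v p) $ i = (\<Sum>l\<in>carrier G. (F l *\<^sub>v p) $ i)"
        using Fc p i by (intro sum_mat_mult_vec_index) auto
      also have "\<dots> = (\<Sum>l\<in>carrier G. (f (l \<otimes> inv d k) *\<^sub>v col T k) $ i)
          - (\<Sum>l\<in>carrier G. if l = s \<otimes> d k then (z k *\<^sub>v p) $ i else 0)"
        using F_vec i by (simp add: sum_subtractf)
      also have "(\<Sum>l\<in>carrier G. (f (l \<otimes> inv d k) *\<^sub>v col T k) $ i) = (E *\<^sub>v col T k) $ i"
        unfolding sum_shift[OF d[OF k], of "\<lambda>h. (f h *\<^sub>v col T k) $ i"] f(2)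
        using fc T i by (intro sum_mat_mult_vec_index[symmetric]) auto
      also have "(\<Sum>l\<in>carrier G. if l = s \<otimes> d k then (z k *\<^sub>v p) $ i else 0) = (z k *\<^sub>v p) $ i"
        using finite_carrier s d[OF k] by simp
      finally show "(sum_mat m m F (carrier G) *\<^sub>v p) $ i = 0\<^sub>v m $ i"
        using z(2)[OF k] i by simp
    qed auto
    from annihilator[OF F this, of "h \<otimes> d k"] have zero: "F (h \<otimes> d k) *\<^sub>v p = 0\<^sub>v m"
      using h d[OF k] by simp
    have hd: "h \<otimes> d k \<in> carrier G" "h \<otimes> d k \<noteq> s \<otimes> d k" "h \<otimes> d k \<otimes> inv d k = h"
      using h s d[OF k] by (auto simp: m_assoc)
    show ?thesis
    proof (rule eq_vecI)
      fix i assume "i < dim_vec (0\<^sub>v m :: 'k vec)"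
      then show "(f h *\<^sub>v col T k) $ i = 0\<^sub>v m $ i" using F_vec[OF hd(1), of i] zero hd by simp
    qed (use fc[OF h(1)] in simp)
  qed
  have f0: "f h = 0\<^sub>m m m" if h: "h \<in> carrier G" "h \<noteq> s" for h
  proof -
    have "f h * T = 0\<^sub>m m m"
    proof (rule mat_col_eqI)
      fix k assume "k < dim_col (0\<^sub>m m m :: 'k mat)"
      then have k: "k < m" by simp
      have "col (f h * T) k = f h *\<^sub>v col T k" using fc[OF h(1)] T k by (intro eq_vecI) auto
      then show "col (f h * T) k = col (0\<^sub>m m m) k" using fT[OF h k] k by simp
    qed (use fc[OF h(1)] T in auto)
    moreover have "f h = f h * T * S"
      using fc[OF h(1)] T by (simp add: assoc_mult_mat_dim)
    ultimately show ?thesis using T by simp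
  qed
  have "E = f s"
  proof (rule eq_matI)
    fix i j assume "i < dim_row (f s)" "j < dim_col (f s)"
    then have i: "i < m" and j: "j < m" using fc[OF s] by auto
    have "E $$ (i, j) = (\<Sum>h\<in>carrier G. f h $$ (i, j))" unfolding f(2) using i j by simp
    also have "\<dots> = (\<Sum>h\<in>carrier G. if h = s then f s $$ (i, j) else 0)"
      using f0 i j by (intro sum.cong) auto
    also have "\<dots> = f s $$ (i, j)" using finite_carrier s by simp
    finally show "E $$ (i, j) = f s $$ (i, j)" .
  qed (use E fc[OF s] in auto)
  then show ?thesis using f(1) s by simp
qed

end

section \<open>Cyclic gradings are isomorphic to good gradings\<close>

theorem theorem3p8:
  fixes G :: "'g monoid"
    and \<A> :: "'g \<Rightarrow> 'k::alg_closed_field mat set"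
    and m n :: nat
  assumes "m > 0" and "n > 0"
    and "group G" and "cyclic_group G" and "Coset.order G = n"
    and "algebra_grading class_ring (matrix_algebra TYPE('k) m) G \<A>"
  shows "\<exists>\<B> :: 'g \<Rightarrow> 'k mat set.
           good_grading m G \<B> \<and>
           grading_isomorphic class_ring G
             (matrix_algebra TYPE('k) m) \<A> (matrix_algebra TYPE('k) m) \<B>"
proof -
  have fin: "finite (carrier G)"
    using assms(2,5) unfolding Coset.order_def by (metis card_gt_0_iff)
  interpret matrix_grading G m \<A>
    by (rule matrix_grading_if_algebra_grading[OF fin assms(6)])
  obtain g p \<psi> where g: "g \<in> carrier G" and p: "p \<in> carrier_vec m" "p \<noteq> 0\<^sub>v m"
    and a: "mat m m (\<lambda>(i, j). p $ i * \<psi> j) \<in> \<A> g" "mat m m (\<lambda>(i, j). p $ i * \<psi> j) \<noteq> 0\<^sub>m m m"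
    using homogeneous_rank_one_exists[OF matrix_grading_axioms assms(4,1)] .
  note annihilator = rank_one_annihilator_graded[OF g p(1) a]
  obtain T where T: "T \<in> carrier_mat m m" "det T \<noteq> 0"
    and cols: "\<forall>k<m. \<exists>d\<in>carrier G. \<exists>x\<in>\<A> d. col T k = x *\<^sub>v p"
    using homogeneous_columns[OF p order_refl] by blast
  from det_non_zero_imp_unit[OF T, of "()"] obtain S where
    S: "S \<in> carrier_mat m m" and ST: "S * T = 1\<^sub>m m" and TS: "T * S = 1\<^sub>m m"
    unfolding Units_def ring_mat_simps by auto
  have "\<forall>k. \<exists>d x. k < m \<longrightarrow> d \<in> carrier G \<and> x \<in> \<A> d \<and> col T k = x *\<^sub>v p" using cols by blast
  then obtain d x where d: "\<And>k. k < m \<Longrightarrow> d k \<in> carrier G"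
    and x: "\<And>k. k < m \<Longrightarrow> x k \<in> \<A> (d k)" "\<And>k. k < m \<Longrightarrow> col T k = x k *\<^sub>v p"
    by metis
  define \<B> where "\<B> = (\<lambda>g. (\<lambda>x. S * x * T) ` \<A> g)"
  have "matrix_grading G m \<B>"
    unfolding \<B>_def by (rule matrix_grading_conjugate[OF matrix_grading_axioms S T(1) ST TS])
  then have "algebra_grading class_ring (matrix_algebra TYPE('k) m) G \<B>"
    by (rule algebra_grading_if_matrix_grading)
  moreover have "homogeneous G \<B> (matrix_unit m i j)" if i: "i < m" and j: "j < m" for i j
  proof -
    define e :: "'k mat" where "e = matrix_unit m i j"
    have e: "e \<in> carrier_mat m m" by (simp add: e_def matrix_unit_def)
    \<comment> \<open>The degree that takes that of column \<open>j\<close> of \<open>T\<close> to that of column \<open>i\<close>.\<close>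
    define s where "s = d i \<otimes>\<^bsub>G\<^esub> inv\<^bsub>G\<^esub> d j"
    have s: "s \<in> carrier G" "s \<otimes>\<^bsub>G\<^esub> d j = d i"
      using d[OF i] d[OF j] by (auto simp: s_def m_assoc)
    define z where "z = (\<lambda>k. if k = j then x i else 0\<^sub>m m m)"
    \<comment> \<open>\<open>T * e * S\<close> sends column \<open>j\<close> of \<open>T\<close> to column \<open>i\<close> and kills the other columns.\<close>
    have "T * e * S \<in> \<A> s"
    proof (rule homogeneous_if_shifts_basis[of p T S d x "T * e * S" s z, OF p(1) _ T(1) S TS d x _ s(1)])
      show "f h *\<^sub>v p = 0\<^sub>v m" if "\<And>h. h \<in> carrier G \<Longrightarrow> f h \<in> \<A> h"
        "sum_mat m m f (carrier G) *\<^sub>v p = 0\<^sub>v m" "h \<in> carrier G" for f h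
        by (rule annihilator[OF that])
      show "T * e * S \<in> carrier_mat m m" using T S e by simp
      show "z k \<in> \<A> (s \<otimes>\<^bsub>G\<^esub> d k)" if "k < m" for k
        using x(1)[OF i] s d[OF that] by (auto simp: z_def zero_mem)
      show "(T * e * S) *\<^sub>v col T k = z k *\<^sub>v p" if k: "k < m" for k
      proof -
        have "S *\<^sub>v col T k = col (S * T) k" using S T(1) k by (intro eq_vecI) auto
        then have "S *\<^sub>v col T k = unit_vec m k" unfolding ST using k by simp
        then have "(T * e * S) *\<^sub>v col T k = T *\<^sub>v (e *\<^sub>v unit_vec m k)"
          using T(1) S e k by (simp add: assoc_mult_mat_vec_dim)
        also have "\<dots> = (if k = j then col T i else 0\<^sub>v m)"
          unfolding e_def matrix_unit_mult_unit_vec[OF i j k]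
          using T(1) i by (auto simp: mult_unit_vec)
        also have "\<dots> = z k *\<^sub>v p" using x(2)[OF i] p by (auto simp: z_def)
        finally show ?thesis .
      qed
    qed
    then have "S * (T * e * S) * T \<in> \<B> s" unfolding \<B>_def by blast
    moreover have "S * (T * e * S) * T = (S * T) * e * (S * T)"
      using S T(1) e by (simp add: assoc_mult_mat_dim)
    then have "S * (T * e * S) * T = e" unfolding ST using e by simp
    ultimately show ?thesis unfolding homogeneous_def e_def using s(1) by auto
  qed
  moreover have "grading_isomorphic class_ring G
      (matrix_algebra TYPE('k) m) \<A> (matrix_algebra TYPE('k) m) \<B>"
    unfolding grading_isomorphic_def \<B>_def using conjugation_algebra_iso[OF S T(1) ST TS] by blast
  ultimately show ?thesis unfolding good_grading_def by blast
qed

end
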